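(* Let $\mathbb{F}$ be a field and let $\mathcal{L}(\lambda)$ be an $(\varepsilon,n,\eta,m)$-block Kronecker pencil over $\mathbb{F}$, that is, $$\mathcal{L}(\lambda)=\begin{bmatrix}\lambda M_1+M_0 & L_\eta(\lambda)^T\otimes I_m\\ L_\varepsilon(\lambda)\otimes I_n & 0\end{bmatrix},$$ where $\lambda M_1+M_0$ is an arbitrary pencil of size $(\eta+1)m\times(\varepsilon+1)n$. Then $\mathcal{L}(\lambda)$ is a strong linearization of the matrix polynomial $$Q(\lambda):=(\Lambda_\eta(\lambda)^T\otimes I_m)(\lambda M_1+M_0)(\Lambda_\varepsilon(\lambda)\otimes I_n)\in\mathbb{F}[\lambda]^{m\times n}$$ of grade $\varepsilon+\eta+1$, the right minimal indices of $\mathcal{L}(\lambda)$ are those of $Q(\lambda)$ shifted by $\varepsilon$, and the left minimal indices of $\mathcal{L}(\lambda)$ are those of $Q(\lambda)$ shifted by $\eta$.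
   Context: $L_k(\lambda)\in\mathbb{F}[\lambda]^{k\times(k+1)}$ is the pencil with $-1$ in positions $(i,i)$, $\lambda$ in positions $(i,i+1)$, $i=1,\dots,k$, and zeros elsewhere; $\Lambda_k(\lambda)^T=[\lambda^k\ \cdots\ \lambda\ 1]\in\mathbb{F}[\lambda]^{1\times(k+1)}$. $\otimes$ is the Kronecker product. $\varepsilon,\eta\ge 0$ are integers; if $\varepsilon=0$ (resp. $\eta=0$) the second block row (resp. second block column) of $\mathcal{L}(\lambda)$ is absent, and $\Lambda_0=1$. A matrix polynomial $P(\lambda)$ has grade $d$ if it is written $\sum_{i=0}^dP_i\lambda^i$ (possibly $P_d=0$). $\mathrm{rev}_dP(\lambda):=\lambda^dP(\lambda^{-1})$. A pencil (grade $1$ matrix polynomial) $\mathcal{L}(\lambda)$ is a linearization of $P(\lambda)$ of grade $d$ if for some $s\ge0$ there are unimodular matrix polynomials (nonzero constant determinant) $U(\lambda),V(\lambda)$ with $U(\lambda)\mathcal{L}(\lambda)V(\lambda)=\mathrm{diag}(I_s,P(\lambda))$; it is a strong linearization if moreover $\mathrm{rev}_1\mathcal{L}(\lambda)$ is a linearization of $\mathrm{rev}_dP(\lambda)$. Right (resp. left) minimal indices of an $m\times n$ matrix polynomial $P$: the ordered list of degrees of the vectors in any polynomial basis, of least total degree among polynomial bases, of $\{x\in\mathbb{F}(\lambda)^{n\times1}:Px=0\}$ (resp. $\{y^T\in\mathbb{F}(\lambda)^{1\times m}:y^TP=0\}$). "The right (left) minimal indices of $\mathcal{L}$ are those of $Q$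 shifted by $k$" means: if $\alpha_1\le\cdots\le\alpha_p$ are the right (left) minimal indices of $Q$, then $\alpha_1+k\le\cdots\le\alpha_p+k$ are the right (left) minimal indices of $\mathcal{L}$. *)

theory Defs
  imports
    "Jordan_Normal_Form.Matrix_Kernel"
    "Jordan_Normal_Form.Determinant"
    "HOL-Computational_Algebra.Polynomial_Factorial"
begin

text \<open>
  Matrix polynomials over the field \<open>'a\<close> are matrices over \<open>'a poly\<close>; matrices with no rows or no
  columns are allowed, so that an absent block is an empty matrix. The field of rational functions is
  \<open>'a poly fract\<close>.
\<close>

definition kron_mat :: "'a::times mat \<Rightarrow> 'a mat \<Rightarrow> 'a mat" (infixl \<open>\<otimes>\<^sub>m\<close> 75) where
  "A \<otimes>\<^sub>m B = mat (dim_row A * dim_row B) (dim_col A * dim_col B)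
     (\<lambda>(i, j). A $$ (i div dim_row B, j div dim_col B) * B $$ (i mod dim_row B, j mod dim_col B))"

definition L_pencil :: "nat \<Rightarrow> 'a::field poly mat" where
  "L_pencil k = mat k (k + 1)
     (\<lambda>(i, j). if j = i then -1 else if j = i + 1 then [:0, 1:] else 0)"

definition Lambda_col :: "nat \<Rightarrow> 'a::field poly mat" where
  "Lambda_col k = mat (k + 1) 1 (\<lambda>(i, _). [:0, 1:] ^ (k - i))"

definition pencil :: "'a::field mat \<Rightarrow> 'a mat \<Rightarrow> 'a poly mat" where
  "pencil M1 M0 = [:0, 1:] \<cdot>\<^sub>m map_mat (\<lambda>a. [:a:]) M1 + map_mat (\<lambda>a. [:a:]) M0"

definition block_kronecker_pencil ::
  "nat \<Rightarrow> nat \<Rightarrow> nat \<Rightarrow> nat \<Rightarrow> 'a::field mat \<Rightarrow> 'a mat \<Rightarrow> 'a poly mat" where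
  "block_kronecker_pencil \<epsilon> n \<eta> m M1 M0 =
     four_block_mat
       (pencil M1 M0)              (transpose_mat (L_pencil \<eta>) \<otimes>\<^sub>m 1\<^sub>m m)
       (L_pencil \<epsilon> \<otimes>\<^sub>m 1\<^sub>m n)      (0\<^sub>m (\<epsilon> * n) (\<eta> * m))"

definition has_grade :: "nat \<Rightarrow> 'a::field poly mat \<Rightarrow> bool" where
  "has_grade d P \<longleftrightarrow> (\<forall>i < dim_row P. \<forall>j < dim_col P. degree (P $$ (i, j)) \<le> d)"

text \<open>For a polynomial \<open>p\<close> of degree at most \<open>d\<close>, \<open>rev_poly d p\<close> is \<open>\<lambda>\<^sup>d p(\<lambda>\<^sup>-\<^sup>1)\<close>.\<close>

definition rev_poly :: "nat \<Rightarrow> 'a::field poly \<Rightarrow> 'a poly" where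
  "rev_poly d p = (\<Sum>i\<le>d. monom (coeff p i) (d - i))"

definition rev_mat :: "nat \<Rightarrow> 'a::field poly mat \<Rightarrow> 'a poly mat" where
  "rev_mat d P = map_mat (rev_poly d) P"

definition unimodular :: "'a::field poly mat \<Rightarrow> bool" where
  "unimodular U \<longleftrightarrow> square_mat U \<and> (\<exists>c. c \<noteq> 0 \<and> det U = [:c:])"

definition linearization :: "nat \<Rightarrow> 'a::field poly mat \<Rightarrow> 'a poly mat \<Rightarrow> bool" where
  "linearization d L P \<longleftrightarrow> has_grade 1 L \<and> has_grade d P \<and>
     (\<exists>s. \<exists>U \<in> carrier_mat (dim_row L) (dim_row L). \<exists>V \<in> carrier_mat (dim_col L) (dim_col L).
        unimodular U \<and> unimodular V \<and>
        U * L * V = four_block_mat (1\<^sub>m s) (0\<^sub>m s (dim_col P)) (0\<^sub>m (dim_row P) s) P)"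

definition strong_linearization :: "nat \<Rightarrow> 'a::field poly mat \<Rightarrow> 'a poly mat \<Rightarrow> bool" where
  "strong_linearization d L P \<longleftrightarrow>
     linearization d L P \<and> linearization d (rev_mat 1 L) (rev_mat d P)"

definition right_null_space :: "'a::field poly mat \<Rightarrow> 'a poly fract vec set" where
  "right_null_space P =
     {x \<in> carrier_vec (dim_col P). map_mat to_fract P *\<^sub>v x = 0\<^sub>v (dim_row P)}"

text \<open>A row vector \<open>y\<^sup>T\<close> of the left null space is represented by the vector \<open>y\<close>.\<close>

definition left_null_space :: "'a::field poly mat \<Rightarrow> 'a poly fract vec set" where
  "left_null_space P =
     {y \<in> carrier_vec (dim_row P). mat_of_row y * map_mat to_fract P = 0\<^sub>m 1 (dim_col P)}"

text \<open>The outer \<open>0\<close> only matters for vectors without entries.\<close>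

definition vec_degree :: "'a::field poly vec \<Rightarrow> nat" where
  "vec_degree v = Max (insert 0 {degree (v $ i) | i. i < dim_vec v})"

text \<open>Here \<open>N\<close> is a subspace of the space of vectors of length \<open>k\<close> over the rational functions.\<close>

definition polynomial_basis ::
  "nat \<Rightarrow> 'a::field poly fract vec set \<Rightarrow> 'a poly vec list \<Rightarrow> bool" where
  "polynomial_basis k N bs \<longleftrightarrow> distinct bs \<and>
     vectorspace.basis class_ring (module_vec TYPE('a poly fract) k\<lparr>carrier := N\<rparr>)
       (set (map (map_vec to_fract) bs))"

definition minimal_basis ::
  "nat \<Rightarrow> 'a::field poly fract vec set \<Rightarrow> 'a poly vec list \<Rightarrow> bool" where
  "minimal_basis k N bs \<longleftrightarrow> polynomial_basis k N bs \<and>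
     (\<forall>cs. polynomial_basis k N cs \<longrightarrow>
        sum_list (map vec_degree bs) \<le> sum_list (map vec_degree cs))"

text \<open>All minimal bases have the same sorted list of degrees, so the choice below is immaterial.\<close>

definition minimal_indices :: "nat \<Rightarrow> 'a::field poly fract vec set \<Rightarrow> nat list" where
  "minimal_indices k N = sort (map vec_degree (SOME bs. minimal_basis k N bs))"

definition right_minimal_indices :: "'a::field poly mat \<Rightarrow> nat list" where
  "right_minimal_indices P = minimal_indices (dim_col P) (right_null_space P)"

definition left_minimal_indices :: "'a::field poly mat \<Rightarrow> nat list" where
  "left_minimal_indices P = minimal_indices (dim_row P) (left_null_space P)"

end

theory Submission
  imports Defs
begin

text \<open>
  Write \<open>A = L\<^sub>\<epsilon> \<otimes> I\<^sub>n\<close>, \<open>B = L\<^sub>\<eta>\<^sup>T \<otimes> I\<^sub>m\<close> and \<open>M = \<lambda> M\<^sub>1 + M\<^sub>0\<close>. Adding one row to \<open>L\<^sub>k\<close> gives a unimodular matrix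
  whose inverse has \<open>\<Lambda>\<^sub>k\<close> as last column, so there are polynomial matrices with
  \<open>A [W\<^sub>1, W\<^sub>2] = [I, 0]\<close>, \<open>W\<^sub>2 = \<Lambda>\<^sub>\<epsilon> \<otimes> I\<^sub>n\<close>, and dually \<open>[Z\<^sub>1; Z\<^sub>2] B = [I; 0]\<close>, \<open>Z\<^sub>2 = \<Lambda>\<^sub>\<eta>\<^sup>T \<otimes> I\<^sub>m\<close>. Block
  elimination with these turns the pencil into \<open>diag(I, Z\<^sub>2 M W\<^sub>2) = diag(I, Q)\<close>. The reversed pencil has the
  same shape, with the completion of \<open>rev L\<^sub>k\<close> in place of that of \<open>L\<^sub>k\<close>.

  The elimination also shows that \<open>z \<mapsto> (W\<^sub>2 z, - Z\<^sub>1 M W\<^sub>2 z)\<close> maps the null space of \<open>Q\<close> bijectively to that of the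
  pencil, with a polynomial inverse. The first component has degree \<open>deg z + \<epsilon>\<close>, and the second
  component \<open>y\<close> satisfies \<open>B y = - M W\<^sub>2 z\<close>, where \<open>B\<close> raises degrees by exactly one; so the map raises degrees
  by exactly \<open>\<epsilon>\<close> and takes minimal bases to minimal bases. That the degrees of a minimal basis do not
  depend on the basis is the uniqueness of the weights of a minimum weight basis. The left
  indices follow by transposition.
\<close>

subsection \<open>Block matrices\<close>

text \<open>Horizontal counterpart of \<open>@\<^sub>r\<close>, encoded in the same way by empty
  blocks, so that facts about \<open>four_block_mat\<close> apply to it.\<close>

definition append_cols :: "'a::zero mat \<Rightarrow> 'a mat \<Rightarrow> 'a mat" (infixr \<open>@\<^sub>c\<close> 66) where
  "A @\<^sub>c B = four_block_mat A B (0\<^sub>m 0 (dim_col A)) (0\<^sub>m 0 (dim_col B))"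

lemma carrier_append_cols [simp, intro]:
  "A \<in> carrier_mat r c \<Longrightarrow> B \<in> carrier_mat r d \<Longrightarrow> A @\<^sub>c B \<in> carrier_mat r (c + d)"
  by (auto simp: append_cols_def)

lemma uminus_zero_mat [simp]: "- 0\<^sub>m r c = (0\<^sub>m r c :: 'a::group_add mat)"
  by (rule eq_matI) auto

lemma zero_mat_mult_vec:
  "v \<in> carrier_vec c \<Longrightarrow> 0\<^sub>m r c *\<^sub>v v = 0\<^sub>v r"
  by (intro eq_vecI) auto

lemma mult_mat_zero_vec:
  "A \<in> carrier_mat r c \<Longrightarrow> A *\<^sub>v 0\<^sub>v c = 0\<^sub>v r"
  by (intro eq_vecI) auto

lemma mult_mat_uminus_vec:
  "A \<in> carrier_mat r c \<Longrightarrow> v \<in> carrier_vec c \<Longrightarrow> A *\<^sub>v (- v) = - (A *\<^sub>v v)"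
  for A :: "'a::comm_ring_1 mat"
  by (intro eq_vecI) auto

lemma eq_uminus_if_add_eq_zero_vec:
  fixes v w :: "'a::comm_ring_1 vec"
  assumes "v \<in> carrier_vec k" "w \<in> carrier_vec k" "v + w = 0\<^sub>v k"
  shows "w = - v"
  using assms by (auto simp: vec_eq_iff add_eq_0_iff)

lemma append_rows_mult:
  assumes "A \<in> carrier_mat r k" "B \<in> carrier_mat s k" "X \<in> carrier_mat k c"
  shows "(A @\<^sub>r B) * X = (A * X) @\<^sub>r (B * X)"
  by (rule eq_matI) (use assms in \<open>auto simp: append_rows_def scalar_prod_def intro!: sum.cong\<close>)

lemma mult_append_cols:
  assumes "A \<in> carrier_mat k c" "B \<in> carrier_mat k d" "X \<in> carrier_mat r k"
  shows "X * (A @\<^sub>c B) = (X * A) @\<^sub>c (X * B)"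
  by (rule eq_matI) (use assms in \<open>auto simp: append_cols_def scalar_prod_def intro!: sum.cong\<close>)

text \<open>Padding both factors with empty blocks makes this the upper left block of a product of
  two \<open>four_block_mat\<close> terms; the other three blocks have no rows or no
  columns.\<close>

lemma append_cols_mult_append_rows:
  assumes "A \<in> carrier_mat r k" "B \<in> carrier_mat r l" "C \<in> carrier_mat k c" "D \<in> carrier_mat l c"
  shows "(A @\<^sub>c B) * (C @\<^sub>r D) = A * C + B * D"
proof -
  have "(A @\<^sub>c B) * (C @\<^sub>r D) =
      four_block_mat A B (0\<^sub>m 0 k) (0\<^sub>m 0 l) * four_block_mat C (0\<^sub>m k 0) D (0\<^sub>m l 0)"
    using assms by (simp add: append_rows_def append_cols_def)
  also have "\<dots> = four_block_mat (A * C + B * D) (A * 0\<^sub>m k 0 + B * 0\<^sub>m l 0)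
      (0\<^sub>m 0 k * C + 0\<^sub>m 0 l * D) (0\<^sub>m 0 k * 0\<^sub>m k 0 + 0\<^sub>m 0 l * 0\<^sub>m l 0)"
    by (rule mult_four_block_mat[OF assms(1,2) zero_carrier_mat zero_carrier_mat
          assms(3) zero_carrier_mat assms(4) zero_carrier_mat])
  also have "\<dots> = A * C + B * D" by (rule eq_matI) (use assms in auto)
  finally show ?thesis .
qed

lemma four_block_mat_conv_append:
  assumes "A \<in> carrier_mat r c" "B \<in> carrier_mat r d" "C \<in> carrier_mat s c" "D \<in> carrier_mat s d"
  shows "four_block_mat A B C D = (A @\<^sub>c B) @\<^sub>r (C @\<^sub>c D)"
  by (rule eq_matI) (use assms in \<open>auto simp: append_rows_def append_cols_def\<close>)

lemma append_cols_add:
  assumes "A \<in> carrier_mat r c" "B \<in> carrier_mat r d" "A' \<in> carrier_mat r c" "B' \<in> carrier_mat r d"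
  shows "A @\<^sub>c B + A' @\<^sub>c B' = (A + A') @\<^sub>c (B + B')"
  by (rule eq_matI) (use assms in \<open>auto simp: append_cols_def\<close>)

text \<open>Reduces each product of transformation matrices below to nine block products. The first
  two blocks are merged into one identity of size \<open>q + p\<close>, the shape that
  \<open>linearization\<close> asks for.\<close>

lemma block3_mult_eq_diag:
  fixes X1 :: "'a::comm_ring_1 mat"
  assumes X: "X1 \<in> carrier_mat q k" "X2 \<in> carrier_mat p k" "X3 \<in> carrier_mat m k"
    and Y: "Y1 \<in> carrier_mat k q" "Y2 \<in> carrier_mat k p" "Y3 \<in> carrier_mat k n"
    and "X1 * Y1 = 1\<^sub>m q" "X1 * Y2 = 0\<^sub>m q p" "X1 * Y3 = 0\<^sub>m q n"
    and "X2 * Y1 = 0\<^sub>m p q" "X2 * Y2 = 1\<^sub>m p" "X2 * Y3 = 0\<^sub>m p n"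
    and "X3 * Y1 = 0\<^sub>m m q" "X3 * Y2 = 0\<^sub>m m p" "X3 * Y3 = G"
  shows "(X1 @\<^sub>r (X2 @\<^sub>r X3)) * (Y1 @\<^sub>c (Y2 @\<^sub>c Y3)) =
    four_block_mat (1\<^sub>m (q + p)) (0\<^sub>m (q + p) n) (0\<^sub>m m (q + p)) G"
proof -
  have G: "G \<in> carrier_mat m n" using X Y assms(15) by auto
  have Y23: "Y2 @\<^sub>c Y3 \<in> carrier_mat k (p + n)" using Y by auto
  have row: "X * (Y1 @\<^sub>c (Y2 @\<^sub>c Y3)) = (X * Y1) @\<^sub>c (X * Y2) @\<^sub>c (X * Y3)"
    if "X \<in> carrier_mat r k" for X r
    unfolding mult_append_cols[OF Y(1) Y23 that] mult_append_cols[OF Y(2,3) that] ..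
  have Yc: "Y1 @\<^sub>c (Y2 @\<^sub>c Y3) \<in> carrier_mat k (q + (p + n))" using Y by auto
  have "(X1 @\<^sub>r (X2 @\<^sub>r X3)) * (Y1 @\<^sub>c (Y2 @\<^sub>c Y3)) =
      (1\<^sub>m q @\<^sub>c 0\<^sub>m q p @\<^sub>c 0\<^sub>m q n) @\<^sub>r (0\<^sub>m p q @\<^sub>c 1\<^sub>m p @\<^sub>c 0\<^sub>m p n) @\<^sub>r (0\<^sub>m m q @\<^sub>c 0\<^sub>m m p @\<^sub>c G)"
    unfolding append_rows_mult[OF X(1) carrier_append_rows[OF X(2,3)] Yc]
      append_rows_mult[OF X(2,3) Yc] row[OF X(1)] row[OF X(2)] row[OF X(3)] assms(7-15) ..
  also have "\<dots> = four_block_mat (1\<^sub>m (q + p)) (0\<^sub>m (q + p) n) (0\<^sub>m m (q + p)) G"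
    by (rule eq_matI) (use G in \<open>auto simp: append_rows_def append_cols_def\<close>)
  finally show ?thesis .
qed

text \<open>The determinants multiply to 1, so both are units of the polynomial ring, which over a
  field are the nonzero constants.\<close>

lemma unimodular_if_inverse:
  fixes X Y :: "'a::field poly mat"
  assumes "X \<in> carrier_mat k k" "Y \<in> carrier_mat k k" "X * Y = 1\<^sub>m k"
  shows "unimodular X" "unimodular Y"
proof -
  have "det X * det Y = 1" using det_mult[OF assms(1,2)] assms(3) by simp
  then have "det X dvd 1" "det Y dvd 1" by (metis dvdI, metis dvdI mult.commute)
  then show "unimodular X" "unimodular Y"
    using assms by (auto simp: unimodular_def is_unit_poly_iff)
qed

text \<open>The stack of \<open>A\<close> over \<open>C\<close> and the row of blocks \<open>W1\<close>, \<open>W2\<close> are inverse to each other.\<close>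

definition complementary ::
  "nat \<Rightarrow> nat \<Rightarrow> 'a::comm_ring_1 mat \<Rightarrow> 'a mat \<Rightarrow> 'a mat \<Rightarrow> 'a mat \<Rightarrow> bool" where
  "complementary p n A C W1 W2 \<longleftrightarrow>
     A \<in> carrier_mat p (p + n) \<and> C \<in> carrier_mat n (p + n) \<and>
     W1 \<in> carrier_mat (p + n) p \<and> W2 \<in> carrier_mat (p + n) n \<and>
     A * W1 = 1\<^sub>m p \<and> A * W2 = 0\<^sub>m p n \<and> C * W1 = 0\<^sub>m n p \<and> C * W2 = 1\<^sub>m n \<and>
     W1 * A + W2 * C = 1\<^sub>m (p + n)"

text \<open>Transposing the two products of mutually inverse matrices swaps the roles of rows and
  columns. This turns a completion of \<open>L_pencil \<eta>\<close> into one of its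
  transpose.\<close>

lemma complementary_transpose:
  assumes "complementary p n A C W1 W2"
  shows "complementary p n W1\<^sup>T W2\<^sup>T A\<^sup>T C\<^sup>T"
proof -
  have c: "A \<in> carrier_mat p (p + n)" "C \<in> carrier_mat n (p + n)"
    "W1 \<in> carrier_mat (p + n) p" "W2 \<in> carrier_mat (p + n) n"
    and e: "A * W1 = 1\<^sub>m p" "A * W2 = 0\<^sub>m p n" "C * W1 = 0\<^sub>m n p" "C * W2 = 1\<^sub>m n"
      "W1 * A + W2 * C = 1\<^sub>m (p + n)"
    using assms by (auto simp: complementary_def)
  have "A\<^sup>T * W1\<^sup>T + C\<^sup>T * W2\<^sup>T = (W1 * A + W2 * C)\<^sup>T"
    using c by (simp add: transpose_add[of _ "p + n" "p + n"] transpose_mult[of _ "p + n" p]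
      transpose_mult[of _ "p + n" n])
  then show ?thesis
    using c e(5) arg_cong[OF e(1), of transpose_mat] arg_cong[OF e(2), of transpose_mat]
      arg_cong[OF e(3), of transpose_mat] arg_cong[OF e(4), of transpose_mat]
    by (simp add: complementary_def transpose_mult[of _ p "p + n"] transpose_mult[of _ n "p + n"])
qed

text \<open>Used for the embedding into rational functions, so that the elimination can be repeated
  over the field in which the null spaces live.\<close>

lemma (in comm_ring_hom) complementary_hom:
  assumes "complementary p n A C W1 W2"
  shows "complementary p n (mat\<^sub>h A) (mat\<^sub>h C) (mat\<^sub>h W1) (mat\<^sub>h W2)"
proof -
  have c: "A \<in> carrier_mat p (p + n)" "C \<in> carrier_mat n (p + n)"
    "W1 \<in> carrier_mat (p + n) p" "W2 \<in> carrier_mat (p + n) n"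
    and e: "A * W1 = 1\<^sub>m p" "A * W2 = 0\<^sub>m p n" "C * W1 = 0\<^sub>m n p" "C * W2 = 1\<^sub>m n"
      "W1 * A + W2 * C = 1\<^sub>m (p + n)"
    using assms by (auto simp: complementary_def)
  have add: "mat\<^sub>h (X + Y) = mat\<^sub>h X + mat\<^sub>h Y"
    if "X \<in> carrier_mat r s" "Y \<in> carrier_mat r s" for X Y r s
    by (rule eq_matI) (use that in \<open>auto simp: hom_add\<close>)
  have zero: "mat\<^sub>h (0\<^sub>m r s) = 0\<^sub>m r s" for r s by (rule eq_matI) auto
  have "mat\<^sub>h W1 * mat\<^sub>h A + mat\<^sub>h W2 * mat\<^sub>h C = mat\<^sub>h (W1 * A + W2 * C)"
    using c by (simp add: add[of _ "p + n" "p + n"] mat_hom_mult[OF c(3,1)] mat_hom_mult[OF c(4,2)])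
  then show ?thesis
    using c e mat_hom_mult[OF c(1,3)] mat_hom_mult[OF c(1,4)] mat_hom_mult[OF c(2,3)]
      mat_hom_mult[OF c(2,4)]
    by (simp add: complementary_def mat_hom_one zero)
qed

section \<open>Block elimination when both off-diagonal blocks have unimodular completions\<close>

locale completed_blocks =
  fixes p n q m :: nat and A C W1 W2 Z1 Z2 B D M :: "'a::comm_ring_1 mat"
  assumes AC: "complementary p n A C W1 W2" and ZB: "complementary q m Z1 Z2 B D"
    and M: "M \<in> carrier_mat (q + m) (p + n)"
begin

lemma carriers:
  "A \<in> carrier_mat p (p + n)" "C \<in> carrier_mat n (p + n)"
  "W1 \<in> carrier_mat (p + n) p" "W2 \<in> carrier_mat (p + n) n"
  "Z1 \<in> carrier_mat q (q + m)" "Z2 \<in> carrier_mat m (q + m)"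
  "B \<in> carrier_mat (q + m) q" "D \<in> carrier_mat (q + m) m"
  using AC ZB by (auto simp: complementary_def)

lemma identities:
  "A * W1 = 1\<^sub>m p" "A * W2 = 0\<^sub>m p n" "C * W1 = 0\<^sub>m n p" "C * W2 = 1\<^sub>m n"
  "W1 * A + W2 * C = 1\<^sub>m (p + n)"
  "Z1 * B = 1\<^sub>m q" "Z1 * D = 0\<^sub>m q m" "Z2 * B = 0\<^sub>m m q" "Z2 * D = 1\<^sub>m m"
  "B * Z1 + D * Z2 = 1\<^sub>m (q + m)"
  using AC ZB by (auto simp: complementary_def)

definition L :: "'a mat" where "L = four_block_mat M B A (0\<^sub>m p q)"
definition Q :: "'a mat" where "Q = Z2 * M * W2"

text \<open>The row operations. \<open>Z1\<close> and \<open>Z2\<close> split the first block row,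
  turning \<open>B\<close> into an identity and a zero block. The last block row also subtracts
  \<open>Z2 * M * W1\<close> times the row of \<open>A\<close>, which leaves only the part of
  \<open>Z2 * M\<close> that factors through \<open>C\<close>.\<close>

definition U :: "'a mat" where
  "U = (Z1 @\<^sub>c 0\<^sub>m q p) @\<^sub>r (0\<^sub>m p (q + m) @\<^sub>c 1\<^sub>m p) @\<^sub>r (Z2 @\<^sub>c - (Z2 * M * W1))"
definition U' :: "'a mat" where
  "U' = (B @\<^sub>r 0\<^sub>m p q) @\<^sub>c ((D * (Z2 * M * W1)) @\<^sub>r 1\<^sub>m p) @\<^sub>c (D @\<^sub>r 0\<^sub>m p m)"
text \<open>The columns are annihilated by the first two block rows of \<open>U * L\<close>:
  \<open>A * W2\<close> vanishes, and the lower block cancels \<open>Z1 * M * W2\<close>. Hence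
  \<open>Phi\<close> is both the last block column of \<open>V\<close> and the map between the null
  spaces.\<close>

definition Phi :: "'a mat" where "Phi = W2 @\<^sub>r - (Z1 * M * W2)"
definition V :: "'a mat" where
  "V = (0\<^sub>m (p + n) q @\<^sub>r 1\<^sub>m q) @\<^sub>c (W1 @\<^sub>r - (Z1 * M * W1)) @\<^sub>c Phi"
text \<open>The parameter lets one computation serve twice: \<open>V' Q\<close> is
  \<open>U * L\<close>, and \<open>V' (1\<^sub>m n)\<close> is the inverse of \<open>V\<close>. The
  product \<open>V' G * V\<close> thus gives the equivalence and the invertibility of
  \<open>V\<close> together.\<close>

definition V' :: "'a mat \<Rightarrow> 'a mat" where
  "V' G = ((Z1 * M) @\<^sub>c 1\<^sub>m q) @\<^sub>r (A @\<^sub>c 0\<^sub>m p q) @\<^sub>r ((G * C) @\<^sub>c 0\<^sub>m (dim_row G) q)"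

lemma carriers_UV:
  "U \<in> carrier_mat (q + m + p) (q + m + p)" "U' \<in> carrier_mat (q + m + p) (q + m + p)"
  "V \<in> carrier_mat (p + n + q) (p + n + q)" 
  "G \<in> carrier_mat r n \<Longrightarrow> V' G \<in> carrier_mat (q + p + r) (p + n + q)"
  "L \<in> carrier_mat (q + m + p) (p + n + q)" "Q \<in> carrier_mat m n"
  "Phi \<in> carrier_mat (p + n + q) n"
  using carriers M by (auto simp: U_def U'_def V_def V'_def L_def Q_def Phi_def append_rows_def append_cols_def)

lemma U_inverse: "U * U' = 1\<^sub>m (q + m + p)"
proof -
  note c = carriers M
  define N where "N = Z2 * M * W1"
  have N: "N \<in> carrier_mat m p" using c by (auto simp: N_def)
  note mult = append_cols_mult_append_rows
  have "U * U' = four_block_mat (1\<^sub>m (q + p)) (0\<^sub>m (q + p) m) (0\<^sub>m m (q + p)) (1\<^sub>m m)"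
    unfolding U_def U'_def N_def[symmetric]
  proof (rule block3_mult_eq_diag[where k = "q + m + p"])
    have DN: "D * N \<in> carrier_mat (q + m) p" using c N by auto
    have mN: "- N \<in> carrier_mat m p" using N by auto
    have ZDN: "Z1 * (D * N) = 0\<^sub>m q p" "Z2 * (D * N) = N"
      using c N identities by (simp_all add: assoc_mult_mat[symmetric, OF _ c(8) N])
    show "(Z1 @\<^sub>c 0\<^sub>m q p) * (B @\<^sub>r 0\<^sub>m p q) = 1\<^sub>m q"
      "(0\<^sub>m p (q + m) @\<^sub>c 1\<^sub>m p) * (B @\<^sub>r 0\<^sub>m p q) = 0\<^sub>m p q"
      "(Z2 @\<^sub>c - N) * (B @\<^sub>r 0\<^sub>m p q) = 0\<^sub>m m q"
      using c N identities
      by (simp_all add: mult[OF c(5) zero_carrier_mat c(7) zero_carrier_mat]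
          mult[OF zero_carrier_mat one_carrier_mat c(7) zero_carrier_mat]
          mult[OF c(6) mN c(7) zero_carrier_mat])
    show "(Z1 @\<^sub>c 0\<^sub>m q p) * (D @\<^sub>r 0\<^sub>m p m) = 0\<^sub>m q m"
      "(0\<^sub>m p (q + m) @\<^sub>c 1\<^sub>m p) * (D @\<^sub>r 0\<^sub>m p m) = 0\<^sub>m p m"
      "(Z2 @\<^sub>c - N) * (D @\<^sub>r 0\<^sub>m p m) = 1\<^sub>m m"
      using c N identities
      by (simp_all add: mult[OF c(5) zero_carrier_mat c(8) zero_carrier_mat]
          mult[OF zero_carrier_mat one_carrier_mat c(8) zero_carrier_mat]
          mult[OF c(6) mN c(8) zero_carrier_mat])
    show "(Z1 @\<^sub>c 0\<^sub>m q p) * ((D * N) @\<^sub>r 1\<^sub>m p) = 0\<^sub>m q p"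
      "(0\<^sub>m p (q + m) @\<^sub>c 1\<^sub>m p) * ((D * N) @\<^sub>r 1\<^sub>m p) = 1\<^sub>m p"
      "(Z2 @\<^sub>c - N) * ((D * N) @\<^sub>r 1\<^sub>m p) = 0\<^sub>m m p"
      using c N DN ZDN identities
      by (simp_all add: mult[OF c(5) zero_carrier_mat DN one_carrier_mat]
          mult[OF zero_carrier_mat one_carrier_mat DN one_carrier_mat]
          mult[OF c(6) mN DN one_carrier_mat] add_uminus_minus_mat minus_r_inv_mat)
  qed (use c N in auto)
  also have "\<dots> = 1\<^sub>m (q + m + p)"
    by (simp add: add_ac)
  finally show ?thesis .
qed

lemma V'_mult_V:
  assumes G: "G \<in> carrier_mat r n"
  shows "V' G * V = four_block_mat (1\<^sub>m (q + p)) (0\<^sub>m (q + p) n) (0\<^sub>m r (q + p)) G"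
  unfolding V_def V'_def Phi_def
proof (rule block3_mult_eq_diag[where k = "p + n + q"])
  note c = carriers M
  note mult = append_cols_mult_append_rows
  have ZM: "Z1 * M \<in> carrier_mat q (p + n)" using c by auto
  have N1: "Z1 * M * W1 \<in> carrier_mat q p" and N2: "Z1 * M * W2 \<in> carrier_mat q n" using c by auto
  have GC: "G * C \<in> carrier_mat r (p + n)" using c G by auto
  have GCW: "G * C * W1 = 0\<^sub>m r p" "G * C * W2 = G"
    using c G identities by (simp_all add: assoc_mult_mat[OF G c(2)])
  have r: "dim_row G = r" using G by auto
  note z = zero_carrier_mat and o = one_carrier_mat
  show "((Z1 * M) @\<^sub>c 1\<^sub>m q) * (0\<^sub>m (p + n) q @\<^sub>r 1\<^sub>m q) = 1\<^sub>m q"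
    "(A @\<^sub>c 0\<^sub>m p q) * (0\<^sub>m (p + n) q @\<^sub>r 1\<^sub>m q) = 0\<^sub>m p q"
    "((G * C) @\<^sub>c 0\<^sub>m (dim_row G) q) * (0\<^sub>m (p + n) q @\<^sub>r 1\<^sub>m q) = 0\<^sub>m r q"
    unfolding r using c ZM GC
    by (simp_all add: r mult[OF ZM o z o] mult[OF c(1) z z o] mult[OF GC z z o])
  show "((Z1 * M) @\<^sub>c 1\<^sub>m q) * (W1 @\<^sub>r - (Z1 * M * W1)) = 0\<^sub>m q p"
    "(A @\<^sub>c 0\<^sub>m p q) * (W1 @\<^sub>r - (Z1 * M * W1)) = 1\<^sub>m p"
    "((G * C) @\<^sub>c 0\<^sub>m (dim_row G) q) * (W1 @\<^sub>r - (Z1 * M * W1)) = 0\<^sub>m r p"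
    unfolding r using c ZM GC N1 GCW identities
    by (simp_all del: assoc_mult_mat add: mult[OF ZM o c(3) uminus_carrier_mat[OF N1]] mult[OF c(1) z c(3) uminus_carrier_mat[OF N1]]
      mult[OF GC z c(3) uminus_carrier_mat[OF N1]] add_uminus_minus_mat minus_r_inv_mat)
  show "((Z1 * M) @\<^sub>c 1\<^sub>m q) * (W2 @\<^sub>r - (Z1 * M * W2)) = 0\<^sub>m q n"
    "(A @\<^sub>c 0\<^sub>m p q) * (W2 @\<^sub>r - (Z1 * M * W2)) = 0\<^sub>m p n"
    "((G * C) @\<^sub>c 0\<^sub>m (dim_row G) q) * (W2 @\<^sub>r - (Z1 * M * W2)) = G"
    unfolding r using c ZM GC N2 GCW identities G
    by (simp_all del: assoc_mult_mat add: mult[OF ZM o c(4) uminus_carrier_mat[OF N2]] mult[OF c(1) z c(4) uminus_carrier_mat[OF N2]]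
      mult[OF GC z c(4) uminus_carrier_mat[OF N2]] add_uminus_minus_mat minus_r_inv_mat)
qed (use carriers M G in auto)

lemma U_mult_L: "U * L = V' Q"
proof -
  note c = carriers M
  note mult = append_cols_mult_append_rows
  note z = zero_carrier_mat and o = one_carrier_mat
  define N where "N = Z2 * M * W1"
  have N: "- N \<in> carrier_mat m p" using c by (auto simp: N_def)
  have MB: "M @\<^sub>c B \<in> carrier_mat (q + m) (p + n + q)" and A0: "A @\<^sub>c 0\<^sub>m p q \<in> carrier_mat p (p + n + q)"
    using c by auto
  have L: "L = (M @\<^sub>c B) @\<^sub>r (A @\<^sub>c 0\<^sub>m p q)"
    unfolding L_def by (rule four_block_mat_conv_append[OF M c(7) c(1) z])
  have Lc: "(M @\<^sub>c B) @\<^sub>r (A @\<^sub>c 0\<^sub>m p q) \<in> carrier_mat (q + m + p) (p + n + q)" using MB A0 by auto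
  have u: "Z1 @\<^sub>c 0\<^sub>m q p \<in> carrier_mat q (q + m + p)"
    "0\<^sub>m p (q + m) @\<^sub>c 1\<^sub>m p \<in> carrier_mat p (q + m + p)" "Z2 @\<^sub>c - N \<in> carrier_mat m (q + m + p)"
    using c N by auto
  have ZM1: "(Z1 * M) @\<^sub>c 1\<^sub>m q \<in> carrier_mat q (p + n + q)" using c by auto
  have "(Z1 @\<^sub>c 0\<^sub>m q p) * L = (Z1 * M) @\<^sub>c 1\<^sub>m q"
    using ZM1 identities
    by (simp add: L mult[OF c(5) z MB A0] mult_append_cols[OF M c(7) c(5)] left_mult_zero_mat[OF A0])
  moreover have "(0\<^sub>m p (q + m) @\<^sub>c 1\<^sub>m p) * L = A @\<^sub>c 0\<^sub>m p q"
    using A0 by (simp add: L mult[OF z o MB A0] left_mult_zero_mat[OF MB] left_mult_one_mat[OF A0])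
  moreover have "(Z2 @\<^sub>c - N) * L = (Q * C) @\<^sub>c 0\<^sub>m m q"
  proof -
    have ZM: "Z2 * M \<in> carrier_mat m (p + n)" using c by auto
    \<comment> \<open>Inserting the resolution of the identity splits \<open>Z2 * M\<close> into a
      multiple of \<open>A\<close>, which the block \<open>- N\<close> of \<open>U\<close> removes,
      and the remainder \<open>Q * C\<close>.\<close>
    have "Z2 * M = Z2 * M * (W1 * A + W2 * C)" using identities right_mult_one_mat[OF ZM] by simp
    also have "\<dots> = Z2 * M * (W1 * A) + Z2 * M * (W2 * C)"
      using c ZM by (intro mult_add_distrib_mat) auto
    also have "\<dots> = N * A + Q * C"
      using c ZM by (simp add: Q_def N_def assoc_mult_mat[OF ZM, symmetric])
    finally have eq: "Z2 * M = N * A + Q * C" .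
    have NA: "N * A \<in> carrier_mat m (p + n)" and QC: "Q * C \<in> carrier_mat m (p + n)"
      using c by (auto simp: Q_def N_def)
    have "Z2 * M + (- N) * A = Q * C"
    proof -
      have "(- N) * A = - (N * A)" using N c by (intro uminus_mult_left_mat) auto
      moreover have "N * A + Q * C + - (N * A) = Q * C"
        by (rule eq_matI) (use carrier_matD[OF NA] carrier_matD[OF QC] in \<open>simp_all del: index_mult_mat(1)\<close>)
      ultimately show ?thesis by (simp add: eq)
    qed
    moreover have "(Z2 @\<^sub>c - N) * L = (Z2 * M) @\<^sub>c (Z2 * B) + ((- N) * A) @\<^sub>c ((- N) * 0\<^sub>m p q)"
      unfolding L mult[OF c(6) N MB A0] mult_append_cols[OF M c(7) c(6)]
        mult_append_cols[OF c(1) z N] ..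
    moreover have "\<dots> = (Z2 * M + (- N) * A) @\<^sub>c (Z2 * B + (- N) * 0\<^sub>m p q)"
      using c N by (intro append_cols_add) auto
    ultimately show ?thesis using N identities by simp
  qed
  ultimately show ?thesis
    using c unfolding U_def V'_def L N_def[symmetric]
    by (subst append_rows_mult[OF u(1) carrier_append_rows[OF u(2,3)] Lc], subst append_rows_mult[OF u(2,3) Lc])
      (simp add: Q_def)
qed

lemma V_inverse: "V' (1\<^sub>m n) * V = 1\<^sub>m (p + n + q)"
  unfolding V'_mult_V[OF one_carrier_mat] by (simp add: add_ac)

lemma equivalence: "U * L * V = four_block_mat (1\<^sub>m (q + p)) (0\<^sub>m (q + p) n) (0\<^sub>m m (q + p)) Q"
  unfolding U_mult_L by (rule V'_mult_V) (use carriers M in \<open>auto simp: Q_def\<close>)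

text \<open>A left inverse over the ring of coefficients itself: with polynomial entries it carries
  polynomial null vectors of \<open>L\<close> back to polynomial null vectors of
  \<open>Q\<close>.\<close>

lemma Psi_mult_Phi: "(C @\<^sub>c 0\<^sub>m n q) * Phi = 1\<^sub>m n"
  unfolding Phi_def using carriers M identities
  by (subst append_cols_mult_append_rows) auto

text \<open>For a null vector with components \<open>x\<close> and \<open>y\<close>, the equation
  \<open>A x = 0\<close> forces \<open>x = W2 (C x)\<close>. Multiplying
  \<open>M x + B y = 0\<close> by \<open>Z1\<close> determines \<open>y\<close>, and multiplying it
  by \<open>Z2\<close> eliminates \<open>y\<close> and says that \<open>C x\<close> is a null vector
  of \<open>Q\<close>.\<close>

lemma mat_kernel_L: "mat_kernel L = (*\<^sub>v) Phi ` mat_kernel Q"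
proof (intro equalityI subsetI)
  note c = carriers M
  have assoc: "Z * M * W2 *\<^sub>v z = Z *\<^sub>v (M *\<^sub>v (W2 *\<^sub>v z))"
    if "Z \<in> carrier_mat r (q + m)" "z \<in> carrier_vec n" for Z r z
  proof -
    have "Z * M * W2 *\<^sub>v z = Z * M *\<^sub>v (W2 *\<^sub>v z)"
      using that c by (intro assoc_mult_mat_vec) auto
    also have "\<dots> = Z *\<^sub>v (M *\<^sub>v (W2 *\<^sub>v z))"
      using that c by (intro assoc_mult_mat_vec) auto
    finally show ?thesis .
  qed
  have Phi: "Phi *\<^sub>v z = (W2 *\<^sub>v z) @\<^sub>v (- (Z1 *\<^sub>v (M *\<^sub>v (W2 *\<^sub>v z))))" if z: "z \<in> carrier_vec n" for z
    unfolding Phi_def assoc[OF c(5) z, symmetric] using z c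
    by (subst mat_mult_append[of _ "p + n" n _ q]) (auto simp del: assoc_mult_mat)
  have Q: "Q *\<^sub>v z = Z2 *\<^sub>v (M *\<^sub>v (W2 *\<^sub>v z))" if z: "z \<in> carrier_vec n" for z
    unfolding Q_def by (rule assoc[OF c(6) z])
  have L: "L *\<^sub>v (x @\<^sub>v y) = 0\<^sub>v (q + m + p) \<longleftrightarrow> M *\<^sub>v x + B *\<^sub>v y = 0\<^sub>v (q + m) \<and> A *\<^sub>v x = 0\<^sub>v p"
    if x: "x \<in> carrier_vec (p + n)" and y: "y \<in> carrier_vec q" for x y
  proof -
    have "A *\<^sub>v x + 0\<^sub>m p q *\<^sub>v y = A *\<^sub>v x" using c x y by (intro eq_vecI) auto
    then have "L *\<^sub>v (x @\<^sub>v y) = (M *\<^sub>v x + B *\<^sub>v y) @\<^sub>v (A *\<^sub>v x)"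
      unfolding L_def using four_block_mat_mult_vec[OF M c(7) c(1) zero_carrier_mat x y] by simp
    moreover have "0\<^sub>v (q + m + p) = 0\<^sub>v (q + m) @\<^sub>v 0\<^sub>v p" by (rule eq_vecI) auto
    moreover have "(M *\<^sub>v x + B *\<^sub>v y) @\<^sub>v (A *\<^sub>v x) = 0\<^sub>v (q + m) @\<^sub>v 0\<^sub>v p \<longleftrightarrow>
        M *\<^sub>v x + B *\<^sub>v y = 0\<^sub>v (q + m) \<and> A *\<^sub>v x = 0\<^sub>v p"
      using c x y by (intro append_vec_eq[of _ "q + m"]) auto
    ultimately show ?thesis by metis
  qed
  {
    fix v assume "v \<in> mat_kernel L"
    then have v: "v \<in> carrier_vec (p + n + q)" "L *\<^sub>v v = 0\<^sub>v (q + m + p)"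
      using mat_kernelD[OF carriers_UV(5)] by auto
    define x y where "x = vec_first v (p + n)" and "y = vec_last v q"
    have xy: "x \<in> carrier_vec (p + n)" "y \<in> carrier_vec q" and vxy: "v = x @\<^sub>v y"
      using v(1) vec_first_last_append[of v "p + n" q] by (auto simp: x_def y_def)
    have eqs: "M *\<^sub>v x + B *\<^sub>v y = 0\<^sub>v (q + m)" "A *\<^sub>v x = 0\<^sub>v p"
      using v(2) L[OF xy] vxy by auto
    define z where "z = C *\<^sub>v x"
    have z: "z \<in> carrier_vec n" using c xy by (auto simp: z_def)
    have "x = (W1 * A + W2 * C) *\<^sub>v x" using identities xy by simp
    also have "\<dots> = W1 * A *\<^sub>v x + W2 * C *\<^sub>v x"
      using c xy by (intro add_mult_distrib_mat_vec) auto
    also have "\<dots> = W1 *\<^sub>v (A *\<^sub>v x) + W2 *\<^sub>v (C *\<^sub>v x)" using c xy by simp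
    also have "\<dots> = W2 *\<^sub>v z" using c z by (simp add: eqs mult_mat_zero_vec[OF c(3)] flip: z_def)
    finally have xz: "x = W2 *\<^sub>v z" .
    have comp: "Z *\<^sub>v (M *\<^sub>v x) + Z * B *\<^sub>v y = 0\<^sub>v r" if Z: "Z \<in> carrier_mat r (q + m)" for Z r
    proof -
      have "0\<^sub>v r = Z *\<^sub>v (M *\<^sub>v x + B *\<^sub>v y)" by (simp add: eqs mult_mat_zero_vec[OF Z])
      also have "\<dots> = Z *\<^sub>v (M *\<^sub>v x) + Z *\<^sub>v (B *\<^sub>v y)"
        using Z c xy by (intro mult_add_distrib_mat_vec) auto
      finally show ?thesis using Z c xy by simp
    qed
    have Zx: "Z1 *\<^sub>v (M *\<^sub>v x) \<in> carrier_vec q" using c xy by auto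
    have "Z1 *\<^sub>v (M *\<^sub>v x) + y = 0\<^sub>v q" using comp[OF c(5)] identities xy by simp
    then have "y = - (Z1 *\<^sub>v (M *\<^sub>v x))"
      by (rule eq_uminus_if_add_eq_zero_vec[OF Zx xy(2)])
    then have "v = Phi *\<^sub>v z" using vxy xz Phi[OF z] by simp
    moreover have "Q *\<^sub>v z = 0\<^sub>v m"
    proof -
      have "Z2 *\<^sub>v (M *\<^sub>v x) \<in> carrier_vec m" using c xy by auto
      then show ?thesis
        using comp[OF c(6)] unfolding Q[OF z] xz[symmetric] identities zero_mat_mult_vec[OF xy(2)] by simp
    qed
    ultimately show "v \<in> (*\<^sub>v) Phi ` mat_kernel Q"
      using z mat_kernelI[OF carriers_UV(6)] by blast
  next
    fix v assume "v \<in> (*\<^sub>v) Phi ` mat_kernel Q"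
    then obtain z where vz: "v = Phi *\<^sub>v z" and "z \<in> mat_kernel Q" by blast
    then have z: "z \<in> carrier_vec n" and Qz: "Z2 *\<^sub>v (M *\<^sub>v (W2 *\<^sub>v z)) = 0\<^sub>v m"
      using mat_kernelD[OF carriers_UV(6)] Q by auto
    define x where "x = W2 *\<^sub>v z"
    have x: "x \<in> carrier_vec (p + n)" using c z by (auto simp: x_def)
    then have Mx: "M *\<^sub>v x \<in> carrier_vec (q + m)" using c by auto
    \<comment> \<open>As \<open>Q z = 0\<close> says that \<open>Z2\<close> kills
      \<open>M x\<close>, the resolution of the identity puts \<open>M x\<close> into the range of
      \<open>B\<close>, with preimage \<open>Z1 (M x)\<close>.\<close>
    have "M *\<^sub>v x = (B * Z1 + D * Z2) *\<^sub>v (M *\<^sub>v x)" using identities Mx by simp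
    also have "\<dots> = B * Z1 *\<^sub>v (M *\<^sub>v x) + D * Z2 *\<^sub>v (M *\<^sub>v x)"
      using c Mx by (intro add_mult_distrib_mat_vec) auto
    also have "\<dots> = B *\<^sub>v (Z1 *\<^sub>v (M *\<^sub>v x)) + D *\<^sub>v (Z2 *\<^sub>v (M *\<^sub>v x))" using c Mx by simp
    also have "\<dots> = B *\<^sub>v (Z1 *\<^sub>v (M *\<^sub>v x))"
      using c x Qz[folded x_def] by (simp add: mult_mat_zero_vec[OF c(8)])
    finally have BZ: "B *\<^sub>v (Z1 *\<^sub>v (M *\<^sub>v x)) = M *\<^sub>v x" ..
    have Zx: "Z1 *\<^sub>v (M *\<^sub>v x) \<in> carrier_vec q" using c x by auto
    have "B *\<^sub>v (- (Z1 *\<^sub>v (M *\<^sub>v x))) = - (M *\<^sub>v x)"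
      using mult_mat_uminus_vec[OF c(7) Zx] by (simp add: BZ)
    then have "M *\<^sub>v x + B *\<^sub>v (- (Z1 *\<^sub>v (M *\<^sub>v x))) = 0\<^sub>v (q + m)" using Mx by auto
    moreover have "A *\<^sub>v x = 0\<^sub>v p"
    proof -
      have "A *\<^sub>v x = (A * W2) *\<^sub>v z" using c z by (simp add: x_def)
      then show ?thesis unfolding identities zero_mat_mult_vec[OF z] .
    qed
    ultimately have "L *\<^sub>v v = 0\<^sub>v (q + m + p)"
      using L[OF x, of "- (Z1 *\<^sub>v (M *\<^sub>v x))"] Zx unfolding vz Phi[OF z] x_def[symmetric] by simp
    then show "v \<in> mat_kernel L"
      using vz z carriers_UV(7) by (intro mat_kernelI[OF carriers_UV(5)]) auto
  }
qed

end

subsection \<open>Kronecker products and bidiagonal pencils\<close>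

lemma kron_mat_carrier [simp]:
  "A \<in> carrier_mat r c \<Longrightarrow> B \<in> carrier_mat s d \<Longrightarrow> A \<otimes>\<^sub>m B \<in> carrier_mat (r * s) (c * d)"
  by (auto simp: kron_mat_def)

lemma transpose_kron_mat: "(A \<otimes>\<^sub>m B)\<^sup>T = A\<^sup>T \<otimes>\<^sub>m B\<^sup>T"
proof (rule eq_matI)
  fix i j assume "i < dim_row (A\<^sup>T \<otimes>\<^sub>m B\<^sup>T)" "j < dim_col (A\<^sup>T \<otimes>\<^sub>m B\<^sup>T)"
  then have i: "i < dim_col A * dim_col B" and j: "j < dim_row A * dim_row B"
    by (auto simp: kron_mat_def)
  then have "0 < dim_col B" "0 < dim_row B" by (auto intro: Nat.gr0I)
  then show "(A \<otimes>\<^sub>m B)\<^sup>T $$ (i, j) = (A\<^sup>T \<otimes>\<^sub>m B\<^sup>T) $$ (i, j)"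
    using i j by (simp add: kron_mat_def less_mult_imp_div_less)
qed (auto simp: kron_mat_def)

lemma kron_one_index:
  fixes A :: "'a::comm_ring_1 mat"
  assumes "A \<in> carrier_mat r c" "i < r * t" "j < c * t"
  shows "(A \<otimes>\<^sub>m 1\<^sub>m t) $$ (i, j) = (if i mod t = j mod t then A $$ (i div t, j div t) else 0)"
proof -
  have "0 < t" using assms by (auto intro: Nat.gr0I)
  then show ?thesis using assms by (simp add: kron_mat_def)
qed

lemma sum_lessThan_mult:
  fixes f :: "nat \<Rightarrow> 'a::comm_monoid_add"
  shows "(\<Sum>i<c * t. f i) = (\<Sum>a<c. \<Sum>b<t. f (a * t + b))"
proof -
  have "(\<Sum>b<t. f (a * t + b)) = sum f {a * t..<a * t + t}" for a
    using sum.shift_bounds_nat_ivl[of f 0 "a * t" t] by (simp add: add.commute atLeast0LessThan)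
  then show ?thesis by (simp add: sum.nat_group)
qed

text \<open>Writing the summation index as \<open>a * t + b\<close>, the identity factor keeps only
  the terms with \<open>b = i mod t\<close>.\<close>

lemma kron_one_mult_vec_index:
  fixes A :: "'a::comm_ring_1 mat"
  assumes A: "A \<in> carrier_mat r c" and z: "z \<in> carrier_vec (c * t)" and i: "i < r * t"
  shows "((A \<otimes>\<^sub>m 1\<^sub>m t) *\<^sub>v z) $ i = (\<Sum>a<c. A $$ (i div t, a) * z $ (a * t + i mod t))"
proof -
  have t: "0 < t" using i by (auto intro: Nat.gr0I)
  have K: "A \<otimes>\<^sub>m 1\<^sub>m t \<in> carrier_mat (r * t) (c * t)" using A by simp
  have lt: "a * t + b < c * t" if "a < c" "b < t" for a b
  proof -
    have "a * t + b < Suc a * t" using that by simp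
    also have "\<dots> \<le> c * t" using that by (intro mult_right_mono) auto
    finally show ?thesis .
  qed
  have "((A \<otimes>\<^sub>m 1\<^sub>m t) *\<^sub>v z) $ i = (\<Sum>j<c * t. (A \<otimes>\<^sub>m 1\<^sub>m t) $$ (i, j) * z $ j)"
    using K z i by (simp add: scalar_prod_def atLeast0LessThan)
  also have "\<dots> = (\<Sum>a<c. \<Sum>b<t. (A \<otimes>\<^sub>m 1\<^sub>m t) $$ (i, a * t + b) * z $ (a * t + b))"
    by (rule sum_lessThan_mult)
  also have "\<dots> = (\<Sum>a<c. \<Sum>b<t. if b = i mod t then A $$ (i div t, a) * z $ (a * t + b) else 0)"
    using lt t i by (intro sum.cong refl) (auto simp: kron_one_index[OF A])
  also have "\<dots> = (\<Sum>a<c. A $$ (i div t, a) * z $ (a * t + i mod t))"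
    using t by simp
  finally show ?thesis .
qed

text \<open>The mixed product rule with identities as right factors, obtained column by column from
  \<open>kron_one_mult_vec_index\<close>.\<close>

lemma kron_one_mult:
  fixes A B :: "'a::comm_ring_1 mat"
  assumes A: "A \<in> carrier_mat r c" and B: "B \<in> carrier_mat c d"
  shows "(A \<otimes>\<^sub>m 1\<^sub>m t) * (B \<otimes>\<^sub>m 1\<^sub>m t) = (A * B) \<otimes>\<^sub>m 1\<^sub>m t"
proof (rule eq_matI)
  have AK: "A \<otimes>\<^sub>m 1\<^sub>m t \<in> carrier_mat (r * t) (c * t)" and BK: "B \<otimes>\<^sub>m 1\<^sub>m t \<in> carrier_mat (c * t) (d * t)"
    and AB: "A * B \<in> carrier_mat r d"
    using A B by simp_all
  fix i j assume "i < dim_row ((A * B) \<otimes>\<^sub>m 1\<^sub>m t)" "j < dim_col ((A * B) \<otimes>\<^sub>m 1\<^sub>m t)"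
  then have i: "i < r * t" and j: "j < d * t" using A B by (auto simp: kron_mat_def)
  then have t: "0 < t" by (auto intro: Nat.gr0I)
  have div: "i div t < r" "j div t < d" using i j by (simp_all add: less_mult_imp_div_less)
  have lt: "a * t + i mod t < c * t" if "a < c" for a
  proof -
    have "a * t + i mod t < Suc a * t" using t by simp
    also have "\<dots> \<le> c * t" using that by (intro mult_right_mono) auto
    finally show ?thesis .
  qed
  have "((A \<otimes>\<^sub>m 1\<^sub>m t) * (B \<otimes>\<^sub>m 1\<^sub>m t)) $$ (i, j) = ((A \<otimes>\<^sub>m 1\<^sub>m t) *\<^sub>v col (B \<otimes>\<^sub>m 1\<^sub>m t) j) $ i"
    using AK BK i j by simp
  also have "\<dots> = (\<Sum>a<c. A $$ (i div t, a) * col (B \<otimes>\<^sub>m 1\<^sub>m t) j $ (a * t + i mod t))"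
    using BK j by (intro kron_one_mult_vec_index[OF A _ i]) auto
  also have "\<dots> = (\<Sum>a<c. if i mod t = j mod t then A $$ (i div t, a) * B $$ (a, j div t) else 0)"
    using BK j lt t by (intro sum.cong refl) (simp add: kron_one_index[OF B])
  also have "\<dots> = (if i mod t = j mod t then (A * B) $$ (i div t, j div t) else 0)"
    using A B div by (simp add: scalar_prod_def atLeast0LessThan)
  also have "\<dots> = ((A * B) \<otimes>\<^sub>m 1\<^sub>m t) $$ (i, j)"
    using kron_one_index[OF AB i j] by simp
  finally show "((A \<otimes>\<^sub>m 1\<^sub>m t) * (B \<otimes>\<^sub>m 1\<^sub>m t)) $$ (i, j) = ((A * B) \<otimes>\<^sub>m 1\<^sub>m t) $$ (i, j)" .
qed (auto simp: kron_mat_def)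

lemma one_kron_one: "1\<^sub>m k \<otimes>\<^sub>m 1\<^sub>m t = (1\<^sub>m (k * t) :: 'a::comm_ring_1 mat)"
proof (rule eq_matI)
  fix i j assume "i < dim_row (1\<^sub>m (k * t) :: 'a mat)" "j < dim_col (1\<^sub>m (k * t) :: 'a mat)"
  then have ij: "i < k * t" "j < k * t" by auto
  then show "(1\<^sub>m k \<otimes>\<^sub>m 1\<^sub>m t) $$ (i, j) = (1\<^sub>m (k * t) :: 'a mat) $$ (i, j)"
    unfolding kron_one_index[OF one_carrier_mat ij]
    by (auto simp: less_mult_imp_div_less) (metis div_mult_mod_eq)
qed (auto simp: kron_mat_def)

lemma zero_kron_one: "0\<^sub>m r c \<otimes>\<^sub>m 1\<^sub>m t = (0\<^sub>m (r * t) (c * t) :: 'a::comm_ring_1 mat)"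
  by (rule eq_matI) (auto simp: kron_mat_def less_mult_imp_div_less)

lemma add_kron_one:
  fixes A B :: "'a::comm_ring_1 mat"
  assumes "A \<in> carrier_mat r c" "B \<in> carrier_mat r c"
  shows "(A + B) \<otimes>\<^sub>m 1\<^sub>m t = A \<otimes>\<^sub>m 1\<^sub>m t + B \<otimes>\<^sub>m 1\<^sub>m t"
  by (rule eq_matI) (use assms in \<open>auto simp: kron_mat_def less_mult_imp_div_less distrib_right\<close>)

text \<open>Tensoring with an identity preserves sums, products, zero and identity matrices, hence
  every equation in \<open>complementary\<close>.\<close>

lemma complementary_kron_one:
  assumes "complementary p n A C W1 W2"
  shows "complementary (p * t) (n * t) (A \<otimes>\<^sub>m 1\<^sub>m t) (C \<otimes>\<^sub>m 1\<^sub>m t) (W1 \<otimes>\<^sub>m 1\<^sub>m t) (W2 \<otimes>\<^sub>m 1\<^sub>m t)"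
proof -
  have c: "A \<in> carrier_mat p (p + n)" "C \<in> carrier_mat n (p + n)"
    "W1 \<in> carrier_mat (p + n) p" "W2 \<in> carrier_mat (p + n) n"
    and e: "A * W1 = 1\<^sub>m p" "A * W2 = 0\<^sub>m p n" "C * W1 = 0\<^sub>m n p" "C * W2 = 1\<^sub>m n"
      "W1 * A + W2 * C = 1\<^sub>m (p + n)"
    using assms by (auto simp: complementary_def)
  have kc: "A \<otimes>\<^sub>m 1\<^sub>m t \<in> carrier_mat (p * t) (p * t + n * t)"
    "C \<otimes>\<^sub>m 1\<^sub>m t \<in> carrier_mat (n * t) (p * t + n * t)"
    "W1 \<otimes>\<^sub>m 1\<^sub>m t \<in> carrier_mat (p * t + n * t) (p * t)"
    "W2 \<otimes>\<^sub>m 1\<^sub>m t \<in> carrier_mat (p * t + n * t) (n * t)"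
    using c by (auto simp flip: distrib_right)
  have "(W1 \<otimes>\<^sub>m 1\<^sub>m t) * (A \<otimes>\<^sub>m 1\<^sub>m t) + (W2 \<otimes>\<^sub>m 1\<^sub>m t) * (C \<otimes>\<^sub>m 1\<^sub>m t) = (W1 * A + W2 * C) \<otimes>\<^sub>m 1\<^sub>m t"
    using c by (simp add: kron_one_mult[OF c(3,1)] kron_one_mult[OF c(4,2)]
        add_kron_one[of _ "p + n" "p + n"])
  then show ?thesis
    using kc e by (simp add: complementary_def kron_one_mult[OF c(1,3)] kron_one_mult[OF c(1,4)]
        kron_one_mult[OF c(2,3)] kron_one_mult[OF c(2,4)] one_kron_one zero_kron_one distrib_right)
qed

section \<open>Bidiagonal matrices and explicit inverses of their completions\<close>

lemma index_mult_mat_sum: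
  assumes "A \<in> carrier_mat r c" "B \<in> carrier_mat c d" "i < r" "j < d"
  shows "(A * B) $$ (i, j) = (\<Sum>l<c. A $$ (i, l) * B $$ (l, j))"
  using assms by (simp add: scalar_prod_def atLeast0LessThan)

text \<open>Covers \<open>L_pencil k\<close>, where \<open>a = - 1\<close> and \<open>b\<close> is
  the indeterminate, and its reversal, where \<open>a\<close> is the negated indeterminate and
  \<open>b = 1\<close>.\<close>

definition bidiagonal :: "nat \<Rightarrow> 'a::comm_ring_1 \<Rightarrow> 'a \<Rightarrow> 'a mat" where
  "bidiagonal k a b = mat k (k + 1) (\<lambda>(i, j). if j = i then a else if j = i + 1 then b else 0)"

lemma bidiagonal_carrier: "bidiagonal k a b \<in> carrier_mat k (k + 1)"
  by (simp add: bidiagonal_def)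

lemma bidiagonal_mult_index:
  assumes X: "X \<in> carrier_mat (k + 1) c" and i: "i < k" and j: "j < c"
  shows "(bidiagonal k a b * X) $$ (i, j) = a * X $$ (i, j) + b * X $$ (i + 1, j)"
proof -
  have "(bidiagonal k a b * X) $$ (i, j) =
      (\<Sum>l<k + 1. (if l = i then a * X $$ (i, j) else 0) + (if l = i + 1 then b * X $$ (i + 1, j) else 0))"
    unfolding index_mult_mat_sum[OF bidiagonal_carrier X i j]
    using i by (intro sum.cong refl) (auto simp: bidiagonal_def)
  also have "\<dots> = a * X $$ (i, j) + b * X $$ (i + 1, j)"
    using i by (subst sum.distrib) simp
  finally show ?thesis .
qed

lemma mult_bidiagonal_index:
  assumes X: "X \<in> carrier_mat r k" and i: "i < r" and j: "j < k + 1"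
  shows "(X * bidiagonal k a b) $$ (i, j) =
    (if j < k then X $$ (i, j) * a else 0) + (if 0 < j then X $$ (i, j - 1) * b else 0)"
proof -
  \<comment> \<open>The guard \<open>0 < j\<close> is needed because truncated subtraction would
    make \<open>j - 1\<close> match the index 0 in the first column.\<close>
  have "(X * bidiagonal k a b) $$ (i, j) =
      (\<Sum>l<k. (if l = j then X $$ (i, j) * a else 0) + (if 0 < j \<and> l = j - 1 then X $$ (i, j - 1) * b else 0))"
    unfolding index_mult_mat_sum[OF X bidiagonal_carrier i j]
    using j by (intro sum.cong refl) (auto simp: bidiagonal_def)
  also have "\<dots> = (if j < k then X $$ (i, j) * a else 0) + (if 0 < j then X $$ (i, j - 1) * b else 0)"
    using j by (subst sum.distrib) auto
  finally show ?thesis .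
qed

lemma L_pencil_conv_bidiagonal: "L_pencil k = bidiagonal k (- 1) [:0, 1:]"
  by (simp add: L_pencil_def bidiagonal_def)

text \<open>Appending the last unit row gives an upper bidiagonal matrix with diagonal entries -1
  and a final 1. Back substitution inverts it, and the powers of \<open>x\<close> come from the
  superdiagonal.\<close>

lemma complementary_bidiagonal:
  fixes x :: "'a::comm_ring_1"
  shows "complementary k 1 (bidiagonal k (- 1) x) (mat 1 (k + 1) (\<lambda>(i, j). if j = k then 1 else 0))
     (mat (k + 1) k (\<lambda>(i, j). if i \<le> j then - (x ^ (j - i)) else 0)) (mat (k + 1) 1 (\<lambda>(i, _). x ^ (k - i)))"
  (is "complementary k 1 ?A ?C ?W1 ?W2")
proof -
  have pow: "x * x ^ (k - Suc i) = x ^ (k - i)" if "i < k" for i k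
    using that by (simp flip: power_Suc add: Suc_diff_Suc)
  have W1: "?W1 \<in> carrier_mat (k + 1) k" and W2: "?W2 \<in> carrier_mat (k + 1) 1"
    by simp_all
  have A: "?A \<in> carrier_mat k (k + 1)" and C: "?C \<in> carrier_mat 1 (k + 1)"
    by (simp_all add: bidiagonal_def)
  have C_mult: "(?C * X) $$ (0, j) = X $$ (k, j)" if "X \<in> carrier_mat (k + 1) c" "j < c" for X c j
  proof -
    have "(?C * X) $$ (0, j) = (\<Sum>l<k + 1. if l = k then X $$ (k, j) else 0)"
      unfolding index_mult_mat_sum[OF C that(1) less_one[THEN iffD2, OF refl] that(2)]
      by (intro sum.cong refl) auto
    then show ?thesis by simp
  qed
  have "?A * ?W1 = 1\<^sub>m k"
  proof (rule eq_matI)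
    fix i j assume "i < dim_row (1\<^sub>m k :: 'a mat)" "j < dim_col (1\<^sub>m k :: 'a mat)"
    then have i: "i < k" and j: "j < k" by auto
    show "(?A * ?W1) $$ (i, j) = 1\<^sub>m k $$ (i, j)"
      unfolding bidiagonal_mult_index[OF W1 i j]
      using i j by (auto simp: pow Suc_le_eq simp del: power_Suc)
  qed (use A in auto)
  moreover have "?A * ?W2 = 0\<^sub>m k 1"
  proof (rule eq_matI)
    fix i j assume "i < dim_row (0\<^sub>m k 1 :: 'a mat)" "j < dim_col (0\<^sub>m k 1 :: 'a mat)"
    then have i: "i < k" and j: "j < 1" by auto
    show "(?A * ?W2) $$ (i, j) = 0\<^sub>m k 1 $$ (i, j)"
      unfolding bidiagonal_mult_index[OF W2 i j]
      using i j by (auto simp: pow simp del: power_Suc)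
  qed (use A W2 in auto)
  moreover have "?C * ?W1 = 0\<^sub>m 1 k"
  proof (rule eq_matI)
    fix i j assume "i < dim_row (0\<^sub>m 1 k :: 'a mat)" "j < dim_col (0\<^sub>m 1 k :: 'a mat)"
    then have i: "i < 1" and j: "j < k" by auto
    show "(?C * ?W1) $$ (i, j) = 0\<^sub>m 1 k $$ (i, j)"
      unfolding less_one[THEN iffD1, OF i] C_mult[OF W1 j]
      using i j by auto
  qed (use W1 in auto)
  moreover have "?C * ?W2 = 1\<^sub>m 1"
  proof (rule eq_matI)
    fix i j assume "i < dim_row (1\<^sub>m 1 :: 'a mat)" "j < dim_col (1\<^sub>m 1 :: 'a mat)"
    then have i: "i < 1" and j: "j < 1" by auto
    show "(?C * ?W2) $$ (i, j) = 1\<^sub>m 1 $$ (i, j)"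
      unfolding less_one[THEN iffD1, OF i] C_mult[OF W2 j]
      using i j by auto
  qed (use W2 in auto)
  moreover have "?W1 * ?A + ?W2 * ?C = 1\<^sub>m (k + 1)"
  proof (rule eq_matI)
    fix i j assume "i < dim_row (1\<^sub>m (k + 1) :: 'a mat)" "j < dim_col (1\<^sub>m (k + 1) :: 'a mat)"
    then have i: "i < k + 1" and j: "j < k + 1" by auto
    have "(?W2 * ?C) $$ (i, j) = (if j = k then x ^ (k - i) else 0)"
      using i j by (simp add: scalar_prod_def)
    \<comment> \<open>The two terms cancel for \<open>i < j < k\<close> and leave 1 on the diagonal.
      In the last column only the second term occurs, and \<open>?W2 * ?C\<close> compensates
      it.\<close>
    moreover have "(?W1 * ?A) $$ (i, j) = (if j < k \<and> i \<le> j then x ^ (j - i) else 0)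
        + (if i < j then - (x ^ (j - i)) else 0)"
      using i j unfolding mult_bidiagonal_index[OF W1 i j]
      by (cases j) (auto simp: Suc_diff_le less_Suc_eq_le)
    ultimately show "(?W1 * ?A + ?W2 * ?C) $$ (i, j) = 1\<^sub>m (k + 1) $$ (i, j)"
      using i j W2 by (auto simp del: index_mult_mat(1))
  qed (use A W2 in auto)
  ultimately show ?thesis using A C W1 W2 by (simp add: complementary_def)
qed

text \<open>Here the first unit row is added. Placed above the bidiagonal matrix it gives a lower
  triangular matrix with unit diagonal, which forward substitution inverts.\<close>

lemma complementary_rev_bidiagonal:
  fixes x :: "'a::comm_ring_1"
  shows "complementary k 1 (bidiagonal k (- x) 1)
     (mat 1 (k + 1) (\<lambda>(i, j). if j = 0 then 1 else 0))
     (mat (k + 1) k (\<lambda>(i, j). if j < i then x ^ (i - 1 - j) else 0))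
     (mat (k + 1) 1 (\<lambda>(i, _). x ^ i))"
  (is "complementary k 1 ?A ?C ?W1 ?W2")
proof -
  have pow: "x * x ^ (i - Suc j) = x ^ (i - j)" if "j < i" for i j
    using that by (simp flip: power_Suc add: Suc_diff_Suc)
  have W1: "?W1 \<in> carrier_mat (k + 1) k" and W2: "?W2 \<in> carrier_mat (k + 1) 1"
    by simp_all
  have A: "?A \<in> carrier_mat k (k + 1)" and C: "?C \<in> carrier_mat 1 (k + 1)"
    by (simp_all add: bidiagonal_def)
  have C_mult: "(?C * X) $$ (0, j) = X $$ (0, j)" if "X \<in> carrier_mat (k + 1) c" "j < c" for X c j
  proof -
    have "(?C * X) $$ (0, j) = (\<Sum>l<k + 1. if l = 0 then X $$ (0, j) else 0)"
      unfolding index_mult_mat_sum[OF C that(1) less_one[THEN iffD2, OF refl] that(2)]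
      by (intro sum.cong refl) auto
    then show ?thesis by simp
  qed
  have "?A * ?W1 = 1\<^sub>m k"
  proof (rule eq_matI)
    fix i j assume "i < dim_row (1\<^sub>m k :: 'a mat)" "j < dim_col (1\<^sub>m k :: 'a mat)"
    then have i: "i < k" and j: "j < k" by auto
    show "(?A * ?W1) $$ (i, j) = 1\<^sub>m k $$ (i, j)"
      unfolding bidiagonal_mult_index[OF W1 i j]
      using i j by (auto simp: pow simp del: power_Suc)
  qed (use A in auto)
  moreover have "?A * ?W2 = 0\<^sub>m k 1"
  proof (rule eq_matI)
    fix i j assume "i < dim_row (0\<^sub>m k 1 :: 'a mat)" "j < dim_col (0\<^sub>m k 1 :: 'a mat)"
    then have i: "i < k" and j: "j < 1" by auto
    show "(?A * ?W2) $$ (i, j) = 0\<^sub>m k 1 $$ (i, j)"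
      unfolding bidiagonal_mult_index[OF W2 i j]
      using i j by auto
  qed (use A in auto)
  moreover have "?C * ?W1 = 0\<^sub>m 1 k"
  proof (rule eq_matI)
    fix i j assume "i < dim_row (0\<^sub>m 1 k :: 'a mat)" "j < dim_col (0\<^sub>m 1 k :: 'a mat)"
    then have i: "i < 1" and j: "j < k" by auto
    show "(?C * ?W1) $$ (i, j) = 0\<^sub>m 1 k $$ (i, j)"
      unfolding less_one[THEN iffD1, OF i] C_mult[OF W1 j]
      using i j by auto
  qed (use W1 in auto)
  moreover have "?C * ?W2 = 1\<^sub>m 1"
  proof (rule eq_matI)
    fix i j assume "i < dim_row (1\<^sub>m 1 :: 'a mat)" "j < dim_col (1\<^sub>m 1 :: 'a mat)"
    then have i: "i < 1" and j: "j < 1" by auto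
    show "(?C * ?W2) $$ (i, j) = 1\<^sub>m 1 $$ (i, j)"
      unfolding less_one[THEN iffD1, OF i] C_mult[OF W2 j]
      using i j by auto
  qed (use W2 in auto)
  moreover have "?W1 * ?A + ?W2 * ?C = 1\<^sub>m (k + 1)"
  proof (rule eq_matI)
    fix i j assume "i < dim_row (1\<^sub>m (k + 1) :: 'a mat)" "j < dim_col (1\<^sub>m (k + 1) :: 'a mat)"
    then have i: "i < k + 1" and j: "j < k + 1" by auto
    have "(?W2 * ?C) $$ (i, j) = (if j = 0 then x ^ i else 0)"
      using i j by (simp add: scalar_prod_def)
    moreover have "(?W1 * ?A) $$ (i, j) = (if j < i then - (x ^ (i - j)) else 0)
        + (if 0 < j \<and> j \<le> i then x ^ (i - j) else 0)"
      using i j pow unfolding mult_bidiagonal_index[OF W1 i j]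
      by (cases j) (auto simp: mult.commute[of _ x])
    ultimately show "(?W1 * ?A + ?W2 * ?C) $$ (i, j) = 1\<^sub>m (k + 1) $$ (i, j)"
      using i j by (auto simp del: index_mult_mat(1))
  qed (use A in auto)
  ultimately show ?thesis using A C W1 W2 by (simp add: complementary_def)
qed

subsection \<open>Bases of minimum weight\<close>

text \<open>The multiplicity of a weight \<open>d\<close> is the difference of the sublevel
  cardinalities at \<open>d\<close> and \<open>d - 1\<close>. Sublevel cardinalities are what the
  exchange argument controls.\<close>

lemma image_mset_mset_set_eqI:
  fixes w :: "'b \<Rightarrow> nat"
  assumes "finite A" "finite B"
    and cnt: "\<And>d. card {a \<in> A. w a \<le> d} = card {b \<in> B. w b \<le> d}"
  shows "image_mset w (mset_set A) = image_mset w (mset_set B)"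
proof (rule multiset_eqI)
  fix d
  have count: "count (image_mset w (mset_set S)) d =
      card {s \<in> S. w s \<le> d} - (if d = 0 then 0 else card {s \<in> S. w s \<le> d - 1})"
    if S: "finite S" for S
  proof -
    have "count (image_mset w (mset_set S)) d = card {s \<in> S. w s = d}"
      using S by (auto simp: count_image_mset Int_def vimage_def intro!: arg_cong[where f = card])
    also have "{s \<in> S. w s = d} = {s \<in> S. w s \<le> d} - (if d = 0 then {} else {s \<in> S. w s \<le> d - 1})"
      by auto
    also have "card \<dots> = card {s \<in> S. w s \<le> d} -
        card (if d = 0 then {} else {s \<in> S. w s \<le> d - 1})"
      using S by (intro card_Diff_subset) auto
    finally show ?thesis by auto
  qed
  show "count (image_mset w (mset_set A)) d = count (image_mset w (mset_set B)) d"
    using assms by (simp add: count)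
qed

context vectorspace
begin

text \<open>The exchanged set is independent because \<open>v\<close> lies outside the span of the
  rest, and it has as many elements as the basis \<open>A\<close>, that is, the dimension.\<close>

lemma basis_exchange:
  assumes A: "finite A" "basis A" and a: "a \<in> A" and v: "v \<in> carrier V"
    and nsp: "v \<notin> span (A - {a})"
  shows "basis (insert v (A - {a}))" and "v \<notin> A - {a}"
proof -
  let ?E = "A - {a}"
  have AV: "A \<subseteq> carrier V" and li: "lin_indpt A"
    using A by (auto simp: basis_def)
  have EV: "?E \<subseteq> carrier V" using AV by auto
  have liE: "lin_indpt ?E" using subset_li_is_li[OF li] by auto
  show vE: "v \<notin> ?E" using nsp span_mem[OF EV] by blast
  have liv: "lin_indpt (insert v ?E)"
    using lin_dep_iff_in_span[OF EV liE v vE] nsp by simp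
  have "fin_dim" unfolding fin_dim_def using A by (auto simp: basis_def)
  moreover have "dim \<le> card (insert v ?E)"
    using dim_basis[OF A] vE a A(1) card_Suc_Diff1[OF A(1) a] by simp
  ultimately show "basis (insert v ?E)"
    using liv A(1) EV v by (intro dim_li_is_basis) auto
qed

text \<open>Coordinates with respect to \<open>A\<close> are unique, so a representation of
  \<open>v\<close> that avoids \<open>a\<close> forces the coordinate at \<open>a\<close> to be
  zero. Only the coordinates in \<open>D\<close> survive.\<close>

lemma in_span_if_removable:
  assumes A: "finite A" "basis A" and D: "D \<subseteq> A" and v: "v \<in> carrier V"
    and rem: "\<And>a. a \<in> A - D \<Longrightarrow> v \<in> span (A - {a})"
  shows "v \<in> span D"
proof -
  have AV: "A \<subseteq> carrier V" using A by (auto simp: basis_def)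
  from basis_criterion[OF A(1) AV] A(2) v
  obtain c where c: "c \<in> A \<rightarrow>\<^sub>E carrier K" "lincomb c A = v"
    and uniq: "\<And>c'. c' \<in> A \<rightarrow>\<^sub>E carrier K \<Longrightarrow> lincomb c' A = v \<Longrightarrow> c' = c"
    by metis
  have cK: "c \<in> A \<rightarrow> carrier K" using c by auto
  have ext: "lincomb (\<lambda>x. if x \<in> E then f x else \<zero>\<^bsub>K\<^esub>) A = lincomb f E"
    if E: "E \<subseteq> A" and f: "f \<in> E \<rightarrow> carrier K" for E f
  proof -
    let ?g = "\<lambda>x. if x \<in> E then f x else \<zero>\<^bsub>K\<^esub>"
    have "lincomb ?g A = lincomb ?g (E \<union> (A - E))" using E by (simp add: Un_absorb1)
    also have "\<dots> = lincomb ?g E \<oplus>\<^bsub>V\<^esub> lincomb ?g (A - E)"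
      using E f A(1) AV finite_subset[OF E A(1)]
      by (intro lincomb_union) (auto simp: Pi_def)
    also have "lincomb ?g (A - E) = \<zero>\<^bsub>V\<^esub>"
      using AV by (intro lincomb_zero) auto
    also have "lincomb ?g E = lincomb f E"
      using E AV f by (intro lincomb_cong) auto
    finally show ?thesis using E AV f finite_subset[OF E A(1)]
      by (simp add: subset_trans[OF E AV])
  qed
  have c0: "c a = \<zero>\<^bsub>K\<^esub>" if a: "a \<in> A - D" for a
  proof -
    have "v \<in> span (A - {a})" by (rule rem[OF a])
    then obtain f where f: "f \<in> (A - {a}) \<rightarrow> carrier K" "lincomb f (A - {a}) = v"
      using finite_in_span[of "A - {a}" v] A(1) AV by auto
    let ?g = "\<lambda>x. if x \<in> A - {a} then f x else \<zero>\<^bsub>K\<^esub>"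
    have g: "?g \<in> A \<rightarrow> carrier K" using f by (auto simp: Pi_def)
    \<comment> \<open>Uniqueness of coordinates is stated for functions that are undefined outside
      \<open>A\<close>, hence the restriction.\<close>
    have "lincomb (restrict ?g A) A = lincomb ?g A"
      using AV g by (intro lincomb_cong) auto
    also have "\<dots> = v" using ext[OF _ f(1)] f(2) by auto
    finally have "restrict ?g A = c" using g by (intro uniq) auto
    then show ?thesis using a by (auto simp: fun_eq_iff split: if_splits)
  qed
  have "v = lincomb (\<lambda>x. if x \<in> D then c x else \<zero>\<^bsub>K\<^esub>) A"
    using AV cK c0 c(2)[symmetric] by (auto intro!: lincomb_cong)
  also have "\<dots> = lincomb c D"
    using D cK by (intro ext) auto
  finally show ?thesis
    using D cK finite_subset[OF D A(1)] unfolding span_def by blast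
qed

text \<open>The exchange argument behind the greedy algorithm: a vector of weight at most \<open>d\<close> that needs
  a basis vector of larger weight could replace it, lowering the total weight.\<close>

lemma min_weight_basis_card_le:
  fixes w :: "'c \<Rightarrow> nat"
  assumes A: "finite A" "basis A" "A \<subseteq> P"
    and min: "\<And>C. finite C \<Longrightarrow> basis C \<Longrightarrow> C \<subseteq> P \<Longrightarrow> sum w A \<le> sum w C"
    and B: "finite B" "lin_indpt B" "B \<subseteq> P" "B \<subseteq> carrier V"
  shows "card {b \<in> B. w b \<le> d} \<le> card {a \<in> A. w a \<le> d}"
proof -
  let ?Ad = "{a \<in> A. w a \<le> d}" let ?Bd = "{b \<in> B. w b \<le> d}"
  have "?Bd \<subseteq> span ?Ad"
  proof
    fix v assume v: "v \<in> ?Bd"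
    then have vV: "v \<in> carrier V" using B by auto
    show "v \<in> span ?Ad"
    proof (rule in_span_if_removable[OF A(1,2) _ vV])
      fix a assume a: "a \<in> A - ?Ad"
      show "v \<in> span (A - {a})"
      proof (rule ccontr)
        assume "v \<notin> span (A - {a})"
        note ex = basis_exchange[OF A(1,2) _ vV this]
        have "sum w A \<le> sum w (insert v (A - {a}))"
          using ex a v A B by (intro min) auto
        also have "\<dots> = w v + sum w (A - {a})" using ex(2) a A(1) by simp
        also have "\<dots> < w a + sum w (A - {a})" using a v by auto
        also have "\<dots> = sum w A" using a A(1) sum.remove[of A a w] by simp
        finally show False by simp
      qed
    qed auto
  qed
  moreover have "lin_indpt ?Bd" using subset_li_is_li[OF B(2)] by auto
  moreover have "?Ad \<subseteq> carrier V" using A by (auto simp: basis_def)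
  moreover have "finite ?Ad" "finite ?Bd" using A(1) B(1) by auto
  \<comment> \<open>Steinitz replacement: the set \<open>C\<close> that completes the independent
    \<open>?Bd\<close> within the span of \<open>?Ad\<close> has nonnegative cardinality, which is
    the claimed inequality.\<close>
  ultimately obtain C :: "'c set" where "int (card C) \<le> int (card ?Ad) - int (card ?Bd)"
    using replacement[of ?Bd ?Ad] by meson
  then show ?thesis by linarith
qed

text \<open>Comparing in both directions makes all sublevel cardinalities equal. \<open>P\<close>
  stands for the polynomial vectors, among which alone minimality is claimed; an exchange never
  leaves \<open>P\<close>.\<close>

lemma min_weight_basis_weights_unique:
  fixes w :: "'c \<Rightarrow> nat"
  assumes A: "finite A" "basis A" "A \<subseteq> P"
    and minA: "\<And>C. finite C \<Longrightarrow> basis C \<Longrightarrow> C \<subseteq> P \<Longrightarrow> sum w A \<le> sum w C"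
    and B: "finite B" "basis B" "B \<subseteq> P"
    and minB: "\<And>C. finite C \<Longrightarrow> basis C \<Longrightarrow> C \<subseteq> P \<Longrightarrow> sum w B \<le> sum w C"
  shows "image_mset w (mset_set A) = image_mset w (mset_set B)"
proof (rule image_mset_mset_set_eqI[OF A(1) B(1)])
  fix d
  show "card {a \<in> A. w a \<le> d} = card {b \<in> B. w b \<le> d}"
    using min_weight_basis_card_le[OF A minA B(1)] min_weight_basis_card_le[OF B minB A(1)] A B
    by (intro antisym) (auto simp: basis_def)
qed

end

subsection \<open>Minimal indices\<close>

interpretation to_fract_hom: inj_comm_ring_hom to_fract
  by unfold_locales auto

lemma inj_map_vec_to_fract: "inj (map_vec to_fract)"
  by (rule injI) (rule to_fract_hom.vec_hom_inj)

lemma right_null_space_conv_mat_kernel: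
  "right_null_space P = mat_kernel (map_mat to_fract P)"
  by (simp add: right_null_space_def mat_kernel_def)

text \<open>Scales a rational null vector to a polynomial one. The factor is the product of all
  denominators, so each numerator picks up the denominators of the other entries.\<close>

lemma ex_common_denominator:
  fixes v :: "'a::field poly fract vec"
  obtains c u where "c \<noteq> 0" and "map_vec to_fract u = to_fract c \<cdot>\<^sub>v v"
proof -
  \<comment> \<open>Every element of the fraction field is a quotient, including the unspecified
    values beyond the dimension, so the choice needs no bound on \<open>i\<close>.\<close>
  have "\<forall>i. \<exists>a b. b \<noteq> 0 \<and> v $ i = to_fract a / to_fract b"
    by (metis Fract_cases Fract_conv_to_fract)
  then obtain a b where b: "\<And>i. b i \<noteq> 0" and v: "\<And>i. v $ i = to_fract (a i) / to_fract (b i)"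
    by metis
  let ?n = "dim_vec v"
  define c where "c = (\<Prod>i<?n. b i)"
  define u where "u = vec ?n (\<lambda>i. a i * (\<Prod>j\<in>{..<?n} - {i}. b j))"
  have "c \<noteq> 0" using b by (simp add: c_def)
  moreover have "map_vec to_fract u = to_fract c \<cdot>\<^sub>v v"
  proof (rule eq_vecI)
    fix i assume "i < dim_vec (to_fract c \<cdot>\<^sub>v v)"
    then have i: "i < ?n" by simp
    then have "c = b i * (\<Prod>j\<in>{..<?n} - {i}. b j)"
      by (simp add: c_def prod.remove[of _ i])
    then show "map_vec to_fract u $ i = (to_fract c \<cdot>\<^sub>v v) $ i"
      using i b[of i] by (simp add: u_def v)
  qed (simp add: u_def)
  ultimately show thesis by (rule that)
qed

context kernel
begin

lemma fin_dim_Ker: "Ker.fin_dim"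
  using kernel_basis_exists[OF A] unfolding Ker.fin_dim_def Ker.basis_def by blast

end

text \<open>A maximal independent set of polynomial null vectors exists because the dimension bounds
  its size. It spans all polynomial null vectors, and every null vector is a scalar multiple of one
  of these.\<close>

lemma ex_polynomial_basis:
  fixes P :: "'a::field poly mat"
  assumes P: "P \<in> carrier_mat r k"
  shows "\<exists>bs. polynomial_basis k (right_null_space P) bs"
proof -
  interpret kernel r k "map_mat to_fract P" by unfold_locales (use P in auto)
  let ?N = "mat_kernel (map_mat to_fract P)"
  let ?R = "range (map_vec to_fract) :: 'a poly fract vec set"
  let ?P = "\<lambda>S. S \<subseteq> ?R \<and> S \<subseteq> ?N \<and> lin_indpt S"
  have "\<exists>S. finite S \<and> maximal S ?P"
  proof (rule maximal_exists)
    show "?P {}" by (auto simp: Ker.lin_dep_def)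
    show "finite S \<and> card S \<le> dim" if "?P S" for S
      using Ker.li_le_dim[OF fin_dim_Ker, of S] that by simp
  qed
  then obtain S where S: "finite S" "?P S" and max: "\<And>T. S \<subseteq> T \<Longrightarrow> ?P T \<Longrightarrow> T = S"
    unfolding maximal_def by metis
  have SN: "S \<subseteq> ?N" and li: "lin_indpt S" using S by auto
  have poly: "x \<in> span S" if x: "x \<in> ?R" "x \<in> ?N" for x
  proof (rule ccontr)
    assume nsp: "x \<notin> span S"
    then have xS: "x \<notin> S" using Ker.span_mem[OF SN] by blast
    have "lin_indpt (S \<union> {x})" using Ker.lin_dep_iff_in_span[OF SN li x(2) xS] nsp by blast
    then have "insert x S = S" using x S by (intro max) auto
    then show False using xS by blast
  qed
  have "v \<in> span S" if v: "v \<in> ?N" for v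
  proof -
    obtain c u where c: "c \<noteq> 0" and u: "map_vec to_fract u = to_fract c \<cdot>\<^sub>v v"
      by (rule ex_common_denominator)
    have "map_vec to_fract u \<in> ?N"
      using u v Ker.smult_closed[of "to_fract c" v] by simp
    then have "map_vec to_fract u \<in> span S" by (intro poly) auto
    then have "inverse (to_fract c) \<cdot>\<^sub>v map_vec to_fract u \<in> span S"
      using submodule.smult_closed[OF Ker.span_is_submodule[OF SN]]
      by (auto simp: class_ring_simps)
    also have "inverse (to_fract c) \<cdot>\<^sub>v map_vec to_fract u = v"
      using c by (auto simp: u smult_smult_assoc)
    finally show ?thesis .
  qed
  then have "span S = ?N" using Ker.span_closed[OF SN] by blast
  then have bas: "basis S" using SN li by (simp add: Ker.basis_def)
  obtain bs where bs: "distinct bs" "set bs = inv_into UNIV (map_vec to_fract) ` S"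
    using finite_distinct_list[OF finite_imageI[OF S(1)]] by metis
  have "map_vec to_fract ` set bs = S"
    using image_inv_into_cancel[OF refl conjunct1[OF S(2)]] bs(2) by simp
  then show ?thesis
    using bas bs by (auto simp: polynomial_basis_def right_null_space_conv_mat_kernel)
qed

lemma ex_minimal_basis:
  fixes P :: "'a::field poly mat"
  assumes P: "P \<in> carrier_mat r k"
  shows "\<exists>bs. minimal_basis k (right_null_space P) bs"
  using ex_polynomial_basis[OF P]
    ex_has_least_nat[of "polynomial_basis k (right_null_space P)" _ "\<lambda>bs. sum_list (map vec_degree bs)"]
  unfolding minimal_basis_def by blast

text \<open>An instance of \<open>min_weight_basis_weights_unique\<close>. Since the embedding is
  injective and the lists are distinct, sums over lists become sums over sets of rational
  vectors.\<close>

lemma minimal_basis_degrees_unique: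
  fixes P :: "'a::field poly mat"
  assumes P: "P \<in> carrier_mat r k"
    and bs: "minimal_basis k (right_null_space P) bs"
    and cs: "minimal_basis k (right_null_space P) cs"
  shows "mset (map vec_degree bs) = mset (map vec_degree cs)"
proof -
  interpret kernel r k "map_mat to_fract P" by unfold_locales (use P in auto)
  let ?h = "map_vec to_fract :: 'a poly vec \<Rightarrow> _"
  \<comment> \<open>The degree of the polynomial preimage, as a weight on rational vectors. It is
    meaningful only on \<open>range ?h\<close>, to which the competing bases are confined.\<close>
  let ?w = "vec_degree \<circ> inv_into UNIV ?h"
  note inj = inj_map_vec_to_fract[where ?'a = "'a poly"]
  have inv: "inv_into UNIV ?h (?h u) = u" for u by (rule inv_f_f[OF inj])
  have poly_basis: "polynomial_basis k (right_null_space P) xs \<longleftrightarrow> distinct xs \<and> basis (?h ` set xs)" for xs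
    by (simp add: polynomial_basis_def right_null_space_conv_mat_kernel)
  have sum: "sum ?w (?h ` set xs) = sum_list (map vec_degree xs)" if "distinct xs" for xs
    using that inj_on_subset[OF inj] by (simp add: sum.reindex inv o_def sum_list_distinct_conv_sum_set)
  have img: "image_mset ?w (mset_set (?h ` set xs)) = mset (map vec_degree xs)"
    if "distinct xs" for xs
  proof -
    have "mset_set (?h ` set xs) = image_mset ?h (mset_set (set xs))"
      by (rule image_mset_mset_set[symmetric]) (rule inj_on_subset[OF inj], simp)
    then show ?thesis using that by (simp add: inv o_def mset_set_set image_mset.compositionality)
  qed
  have min: "sum ?w (?h ` set xs) \<le> sum ?w C"
    if xs: "minimal_basis k (right_null_space P) xs"
      and C: "finite C" "basis C" "C \<subseteq> range ?h" for xs C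
  proof -
    obtain ys where ys: "distinct ys" "set ys = inv_into UNIV ?h ` C"
      using finite_distinct_list[OF finite_imageI[OF C(1)]] by metis
    have Cys: "C = ?h ` set ys" using image_inv_into_cancel[OF refl C(3)] ys(2) by simp
    then have "polynomial_basis k (right_null_space P) ys" using ys C by (simp add: poly_basis)
    moreover have "distinct xs" using xs by (simp add: minimal_basis_def poly_basis)
    ultimately show ?thesis
      using xs unfolding Cys sum[OF ys(1)] sum[OF \<open>distinct xs\<close>] minimal_basis_def by blast
  qed
  have "image_mset ?w (mset_set (?h ` set bs)) = image_mset ?w (mset_set (?h ` set cs))"
  proof (rule Ker.min_weight_basis_weights_unique[where P = "range ?h"])
    show "basis (?h ` set bs)" "basis (?h ` set cs)"
      using bs cs by (simp_all add: minimal_basis_def poly_basis)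
  qed (use min[OF bs] min[OF cs] in auto)
  then show ?thesis using bs cs img by (auto simp: minimal_basis_def poly_basis)
qed

text \<open>Makes the choice in \<open>minimal_indices\<close> harmless: the indices can be read off
  any minimal basis at hand.\<close>

lemma minimal_indices_eqI:
  fixes P :: "'a::field poly mat"
  assumes P: "P \<in> carrier_mat r k" and bs: "minimal_basis k (right_null_space P) bs"
  shows "minimal_indices k (right_null_space P) = sort (map vec_degree bs)"
proof -
  have "minimal_basis k (right_null_space P) (SOME bs. minimal_basis k (right_null_space P) bs)"
    using bs by (rule someI)
  from minimal_basis_degrees_unique[OF P this bs] show ?thesis
    unfolding minimal_indices_def by (metis sorted_list_of_multiset_mset)
qed

text \<open>A common length is what makes a uniform shift of degrees change the total of every basis
  by the same amount.\<close>

lemma length_polynomial_basis: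
  fixes P :: "'a::field poly mat"
  assumes P: "P \<in> carrier_mat r k"
    and bs: "polynomial_basis k (right_null_space P) bs"
  shows "length bs = kernel.dim k (map_mat to_fract P)"
proof -
  interpret kernel r k "map_mat to_fract P" by unfold_locales (use P in auto)
  have "basis (map_vec to_fract ` set bs)" "distinct bs"
    using bs by (auto simp: polynomial_basis_def right_null_space_conv_mat_kernel)
  then show ?thesis
    using Ker.dim_basis[of "map_vec to_fract ` set bs"]
      card_image[OF inj_on_subset[OF inj_map_vec_to_fract, of "set bs"]]
    by (simp add: distinct_card)
qed

lemma polynomial_basis_in_null_space:
  fixes P :: "'a::field poly mat"
  assumes P: "P \<in> carrier_mat r k"
    and bs: "polynomial_basis k (right_null_space P) bs" and v: "v \<in> set bs"
  shows "map_vec to_fract v \<in> right_null_space P" "v \<in> carrier_vec k" "v \<noteq> 0\<^sub>v k"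
proof -
  interpret kernel r k "map_mat to_fract P" by unfold_locales (use P in auto)
  have bas: "basis (map_vec to_fract ` set bs)"
    using bs by (auto simp: polynomial_basis_def right_null_space_conv_mat_kernel)
  then show N: "map_vec to_fract v \<in> right_null_space P"
    using v unfolding Ker.basis_def right_null_space_conv_mat_kernel by auto
  then have "dim_vec (map_vec to_fract v) = k"
    using P unfolding right_null_space_def by auto
  then show "v \<in> carrier_vec k" by (intro carrier_vecI) simp
  show "v \<noteq> 0\<^sub>v k"
  proof
    assume "v = 0\<^sub>v k"
    then have "0\<^sub>v k \<in> map_vec to_fract ` set bs"
      using v to_fract_hom.vec_hom_zero[of k] by force
    then show False using bas Ker.vs_zero_lin_dep[of "map_vec to_fract ` set bs"]
      by (simp add: Ker.basis_def)
  qed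
qed

text \<open>Over the rational functions \<open>F\<close> is a linear isomorphism of the null spaces,
  and its polynomial entries keep vectors polynomial. It is applied both to the shifting map and to
  its left inverse.\<close>

lemma polynomial_basis_image:
  fixes P P' F :: "'a::field poly mat"
  assumes P: "P \<in> carrier_mat r k" and P': "P' \<in> carrier_mat r' k'" and F: "F \<in> carrier_mat k' k"
    and im: "right_null_space P' = (*\<^sub>v) (map_mat to_fract F) ` right_null_space P"
    and inj: "inj_on ((*\<^sub>v) (map_mat to_fract F)) (right_null_space P)"
    and bs: "polynomial_basis k (right_null_space P) bs"
  shows "polynomial_basis k' (right_null_space P') (map ((*\<^sub>v) F) bs)"
proof -
  interpret N: kernel r k "map_mat to_fract P" by unfold_locales (use P in auto)
  interpret N': kernel r' k' "map_mat to_fract P'" by unfold_locales (use P' in auto)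
  let ?T = "(*\<^sub>v) (map_mat to_fract F)"
  note ker = right_null_space_conv_mat_kernel
  have Fc: "map_mat to_fract F \<in> carrier_mat k' k" using F by auto
  have sub: "x \<in> carrier_vec k" if "x \<in> mat_kernel (map_mat to_fract P)" for x
    using that N.A mat_kernel by blast
  interpret T: linear_map class_ring N.VK N'.VK ?T
  proof unfold_locales
    show "?T \<in> LinearCombinations.module_hom class_ring N.VK N'.VK"
      using im sub mult_add_distrib_mat_vec[OF Fc] mult_mat_vec[OF Fc]
      by (auto simp: LinearCombinations.module_hom_def ker class_ring_simps module_vec_simps)
  qed
  have bas: "N.basis (map_vec to_fract ` set bs)" and dist: "distinct bs"
    using bs by (auto simp: polynomial_basis_def ker)
  have "N'.basis (?T ` map_vec to_fract ` set bs)"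
    using inj im bas N.fin_dim_Ker by (intro T.linear_inj_image_is_basis) (auto simp: ker)
  moreover have hom: "?T (map_vec to_fract v) = map_vec to_fract (F *\<^sub>v v)" if "v \<in> set bs" for v
    using to_fract_hom.mult_mat_vec_hom[OF F polynomial_basis_in_null_space(2)[OF P bs that]] by simp
  moreover have "?T ` map_vec to_fract ` set bs = map_vec to_fract ` (*\<^sub>v) F ` set bs"
    unfolding image_image by (rule image_cong[OF refl hom])
  moreover have "inj_on ((*\<^sub>v) F) (set bs)"
  proof (rule inj_onI)
    fix u v assume uv: "u \<in> set bs" "v \<in> set bs" "F *\<^sub>v u = F *\<^sub>v v"
    then have "?T (map_vec to_fract u) = ?T (map_vec to_fract v)" by (simp add: hom)
    then have "map_vec to_fract u = map_vec to_fract v"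
      using inj_onD[OF inj] uv polynomial_basis_in_null_space(1)[OF P bs] by blast
    then show "u = v" by (rule to_fract_hom.vec_hom_inj)
  qed
  ultimately show ?thesis
    using dist by (simp add: polynomial_basis_def ker distinct_map image_image)
qed

lemma sort_map_add_const: "sort (map (\<lambda>\<alpha>. \<alpha> + e) xs) = map (\<lambda>\<alpha>. \<alpha> + e) (sort xs)" for e :: nat
  by (intro properties_for_sort) (auto simp: sorted_map sorted_wrt_map intro: sorted_wrt_mono_rel[of _ "(\<le>)"])

text \<open>\<open>F\<close> and \<open>G\<close> carry polynomial bases of the two null spaces to
  each other, with degrees differing by \<open>e\<close> throughout. The totals then differ by the
  constant dimension times \<open>e\<close>, so least totals correspond.\<close>

lemma right_minimal_indices_shift:
  fixes P P' F G :: "'a::field poly mat"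
  assumes P: "P \<in> carrier_mat r k" and P': "P' \<in> carrier_mat r' k'"
    and F: "F \<in> carrier_mat k' k" and G: "G \<in> carrier_mat k k'" and GF: "G * F = 1\<^sub>m k"
    and im: "right_null_space P' = (*\<^sub>v) (map_mat to_fract F) ` right_null_space P"
    and deg: "\<And>z. z \<in> carrier_vec k \<Longrightarrow> map_vec to_fract z \<in> right_null_space P \<Longrightarrow> z \<noteq> 0\<^sub>v k \<Longrightarrow>
      vec_degree (F *\<^sub>v z) = vec_degree z + e"
  shows "right_minimal_indices P' = map (\<lambda>\<alpha>. \<alpha> + e) (right_minimal_indices P)"
proof -
  let ?F = "map_mat to_fract F" let ?G = "map_mat to_fract G"
  have Fc: "?F \<in> carrier_mat k' k" and Gc: "?G \<in> carrier_mat k k'" using F G by auto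
  have GF': "?G * ?F = 1\<^sub>m k"
    using to_fract_hom.mat_hom_mult[OF G F] GF to_fract_hom.mat_hom_one[of k] by metis
  have sub: "x \<in> carrier_vec k" if "x \<in> right_null_space P" for x
    using that P by (auto simp: right_null_space_def)
  have GFx: "?G *\<^sub>v (?F *\<^sub>v x) = x" if "x \<in> right_null_space P" for x
    using assoc_mult_mat_vec[OF Gc Fc sub[OF that]] sub[OF that] GF' by simp
  have injF: "inj_on ((*\<^sub>v) ?F) (right_null_space P)"
    using GFx by (metis inj_onI)
  \<comment> \<open>On the image of \<open>?F\<close>, which is the whole null space of
    \<open>P'\<close>, the matrix \<open>?G\<close> undoes \<open>?F\<close>.\<close>
  have injG: "inj_on ((*\<^sub>v) ?G) (right_null_space P')"
    unfolding im by (rule inj_onI) (use GFx in auto)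
  have imG: "right_null_space P = (*\<^sub>v) ?G ` right_null_space P'"
    unfolding im image_image using GFx by auto
  have degF: "map vec_degree (map ((*\<^sub>v) F) bs) = map (\<lambda>\<alpha>. \<alpha> + e) (map vec_degree bs)"
    if "polynomial_basis k (right_null_space P) bs" for bs
    using polynomial_basis_in_null_space[OF P that] deg by auto
  have shift_sum: "sum_list (map (\<lambda>\<alpha>. \<alpha> + e) xs) = sum_list xs + length xs * e" for xs :: "nat list"
    by (induction xs) auto
  obtain bs where bs: "minimal_basis k (right_null_space P) bs"
    using ex_minimal_basis[OF P] by blast
  then have bs': "polynomial_basis k (right_null_space P) bs" by (simp add: minimal_basis_def)
  have "minimal_basis k' (right_null_space P') (map ((*\<^sub>v) F) bs)"
    unfolding minimal_basis_def
  proof (intro conjI allI impI)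
    show "polynomial_basis k' (right_null_space P') (map ((*\<^sub>v) F) bs)"
      by (rule polynomial_basis_image[OF P P' F im injF bs'])
    fix cs assume cs: "polynomial_basis k' (right_null_space P') cs"
    let ?ds = "map ((*\<^sub>v) G) cs"
    have ds: "polynomial_basis k (right_null_space P) ?ds"
      by (rule polynomial_basis_image[OF P' P G imG injG cs])
    \<comment> \<open>\<open>G\<close> is only a left inverse of \<open>F\<close>; the reverse
      composition is the identity here because \<open>c\<close> lies in the image of
      \<open>F\<close> over the rational functions.\<close>
    have "F *\<^sub>v (G *\<^sub>v c) = c" if "c \<in> set cs" for c
    proof -
      note c = polynomial_basis_in_null_space[OF P' cs that]
      from c(1) obtain x where x: "x \<in> right_null_space P" "map_vec to_fract c = ?F *\<^sub>v x"
        unfolding im by blast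
      have "map_vec to_fract (F *\<^sub>v (G *\<^sub>v c)) = ?F *\<^sub>v (?G *\<^sub>v map_vec to_fract c)"
        using F G c(2) by (simp add: to_fract_hom.mult_mat_vec_hom[of _ k' k] to_fract_hom.mult_mat_vec_hom[of _ k k'])
      also have "\<dots> = map_vec to_fract c" using GFx[OF x(1)] x(2) by simp
      finally show ?thesis by (rule to_fract_hom.vec_hom_inj)
    qed
    then have cs_eq: "map ((*\<^sub>v) F) ?ds = cs" by (simp add: map_idI)
    have "sum_list (map vec_degree (map ((*\<^sub>v) F) bs)) = sum_list (map vec_degree bs) + length bs * e"
      unfolding degF[OF bs'] shift_sum by simp
    also have "\<dots> \<le> sum_list (map vec_degree ?ds) + length ?ds * e"
    proof -
      have "sum_list (map vec_degree bs) \<le> sum_list (map vec_degree ?ds)"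
        using bs ds unfolding minimal_basis_def by blast
      then show ?thesis using length_polynomial_basis[OF P bs'] length_polynomial_basis[OF P ds] by simp
    qed
    also have "\<dots> = sum_list (map vec_degree cs)"
      unfolding degF[OF ds, unfolded cs_eq] shift_sum by simp
    finally show "sum_list (map vec_degree (map ((*\<^sub>v) F) bs)) \<le> sum_list (map vec_degree cs)" .
  qed
  from minimal_indices_eqI[OF P' this] minimal_indices_eqI[OF P bs] degF[OF bs'] P P'
  show ?thesis by (simp only: right_minimal_indices_def carrier_matD sort_map_add_const)
qed

section \<open>Left minimal indices by transposition\<close>

lemma left_null_space_conv_transpose: "left_null_space P = right_null_space P\<^sup>T"
proof -
  let ?P = "map_mat to_fract P"
  have "mat_of_row y * ?P = 0\<^sub>m 1 (dim_col P) \<longleftrightarrow> ?P\<^sup>T *\<^sub>v y = 0\<^sub>v (dim_col P)"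
    if "y \<in> carrier_vec (dim_row P)" for y
    using that by (auto simp: mat_eq_iff vec_eq_iff comm_scalar_prod[of y "dim_row P"])
  moreover have "?P\<^sup>T = map_mat to_fract P\<^sup>T"
    by (rule eq_matI) auto
  ultimately show ?thesis
    unfolding left_null_space_def right_null_space_def by (simp cong: conj_cong)
qed

lemma left_minimal_indices_conv_transpose: "left_minimal_indices P = right_minimal_indices P\<^sup>T"
  by (simp add: left_minimal_indices_def right_minimal_indices_def left_null_space_conv_transpose)

subsection \<open>Grade and reversal\<close>

lemma coeff_rev_poly: "coeff (rev_poly d p) k = (if k \<le> d then coeff p (d - k) else 0)"
proof -
  have "coeff (rev_poly d p) k = (\<Sum>i\<le>d. if d - i = k then coeff p i else 0)"
    by (simp add: rev_poly_def coeff_sum)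
  also have "\<dots> = (\<Sum>i\<le>d. if i = d - k then (if k \<le> d then coeff p i else 0) else 0)"
    by (intro sum.cong) auto
  finally show ?thesis by simp
qed

lemma rev_poly_0 [simp]: "rev_poly d 0 = 0"
  and rev_poly_add: "rev_poly d (p + q) = rev_poly d p + rev_poly d q"
  by (auto simp: poly_eq_iff coeff_rev_poly)

lemma rev_poly_sum: "rev_poly d (sum f S) = (\<Sum>i\<in>S. rev_poly d (f i))"
  by (induction S rule: infinite_finite_induct) (auto simp: rev_poly_add)

lemma degree_rev_poly_le: "degree (rev_poly d p) \<le> d"
  by (rule degree_le) (simp add: coeff_rev_poly)

text \<open>\<open>reflect_poly\<close> reverses with respect to the actual degree; the monomial
  makes up for the gap between degree and grade. This brings in the multiplicativity of
  \<open>reflect_poly\<close>.\<close>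

lemma rev_poly_conv_reflect_poly:
  "degree p \<le> d \<Longrightarrow> rev_poly d p = monom 1 (d - degree p) * reflect_poly p"
  by (rule poly_eqI) (auto simp: coeff_rev_poly coeff_monom_mult coeff_reflect_poly coeff_eq_0)

text \<open>For nonzero factors the degrees add, so the gaps between degree and grade add as well. A
  zero factor is treated apart because the degree formula fails there.\<close>

lemma rev_poly_mult:
  assumes "degree p \<le> a" "degree q \<le> b"
  shows "rev_poly (a + b) (p * q) = rev_poly a p * rev_poly b q"
proof (cases "p = 0 \<or> q = 0")
  case False
  then have deg: "degree (p * q) = degree p + degree q" by (simp add: degree_mult_eq)
  have "monom 1 (a + b - degree (p * q)) = (monom 1 (a - degree p) * monom 1 (b - degree q) :: 'a poly)"
    using assms by (simp add: deg mult_monom)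
  then show ?thesis
    using assms by (simp add: rev_poly_conv_reflect_poly deg reflect_poly_mult ac_simps)
qed auto

lemma has_grade_rev_mat: "has_grade d (rev_mat d P)"
  by (simp add: has_grade_def rev_mat_def degree_rev_poly_le)

lemma has_grade_mult:
  assumes "A \<in> carrier_mat r c" "B \<in> carrier_mat c s" "has_grade a A" "has_grade b B"
  shows "has_grade (a + b) (A * B)"
  unfolding has_grade_def
proof (intro allI impI)
  fix i j assume "i < dim_row (A * B)" "j < dim_col (A * B)"
  then have ij: "i < r" "j < s" using assms by auto
  have "degree (A $$ (i, l) * B $$ (l, j)) \<le> a + b" if "l < c" for l
  proof -
    have "degree (A $$ (i, l)) \<le> a" "degree (B $$ (l, j)) \<le> b"
      using assms ij that by (auto simp: has_grade_def)
    then show ?thesis using degree_mult_le[of "A $$ (i, l)" "B $$ (l, j)"] by linarith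
  qed
  then show "degree ((A * B) $$ (i, j)) \<le> a + b"
    unfolding index_mult_mat_sum[OF assms(1,2) ij] by (intro degree_sum_le) auto
qed

lemma rev_mat_mult:
  assumes "A \<in> carrier_mat r c" "B \<in> carrier_mat c s" "has_grade a A" "has_grade b B"
  shows "rev_mat (a + b) (A * B) = rev_mat a A * rev_mat b B"
proof (rule eq_matI)
  have rc: "rev_mat a A \<in> carrier_mat r c" "rev_mat b B \<in> carrier_mat c s"
    using assms by (auto simp: rev_mat_def)
  fix i j assume "i < dim_row (rev_mat a A * rev_mat b B)" "j < dim_col (rev_mat a A * rev_mat b B)"
  then have ij: "i < r" "j < s" using rc by auto
  have "rev_poly (a + b) (A $$ (i, l) * B $$ (l, j)) = rev_mat a A $$ (i, l) * rev_mat b B $$ (l, j)"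
    if "l < c" for l
    using assms ij that by (subst rev_poly_mult) (auto simp: has_grade_def rev_mat_def)
  then show "rev_mat (a + b) (A * B) $$ (i, j) = (rev_mat a A * rev_mat b B) $$ (i, j)"
    unfolding index_mult_mat_sum[OF rc ij]
    using assms ij index_mult_mat_sum[OF assms(1,2) ij] by (simp add: rev_mat_def rev_poly_sum)
qed (use assms in \<open>auto simp: rev_mat_def\<close>)

lemma has_grade_kron_one: "has_grade d A \<Longrightarrow> has_grade d (A \<otimes>\<^sub>m 1\<^sub>m t)"
  unfolding has_grade_def
proof (intro allI impI)
  fix i j assume A: "\<forall>i<dim_row A. \<forall>j<dim_col A. degree (A $$ (i, j)) \<le> d"
    and "i < dim_row (A \<otimes>\<^sub>m 1\<^sub>m t)" "j < dim_col (A \<otimes>\<^sub>m 1\<^sub>m t)"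
  then have "i < dim_row A * t" "j < dim_col A * t" by (auto simp: kron_mat_def)
  then show "degree ((A \<otimes>\<^sub>m 1\<^sub>m t) $$ (i, j)) \<le> d"
    using A by (simp add: kron_one_index[of A "dim_row A" "dim_col A"] less_mult_imp_div_less)
qed

lemma rev_mat_kron_one: "rev_mat d (A \<otimes>\<^sub>m 1\<^sub>m t) = rev_mat d A \<otimes>\<^sub>m 1\<^sub>m t"
proof (rule eq_matI)
  have A: "A \<in> carrier_mat (dim_row A) (dim_col A)" "rev_mat d A \<in> carrier_mat (dim_row A) (dim_col A)"
    by (auto simp: rev_mat_def)
  fix i j assume "i < dim_row (rev_mat d A \<otimes>\<^sub>m 1\<^sub>m t)" "j < dim_col (rev_mat d A \<otimes>\<^sub>m 1\<^sub>m t)"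
  then have ij: "i < dim_row A * t" "j < dim_col A * t" by (auto simp: kron_mat_def rev_mat_def)
  then have "rev_mat d (A \<otimes>\<^sub>m 1\<^sub>m t) $$ (i, j) = rev_poly d ((A \<otimes>\<^sub>m 1\<^sub>m t) $$ (i, j))"
    by (simp add: rev_mat_def kron_mat_def)
  then show "rev_mat d (A \<otimes>\<^sub>m 1\<^sub>m t) $$ (i, j) = (rev_mat d A \<otimes>\<^sub>m 1\<^sub>m t) $$ (i, j)"
    unfolding kron_one_index[OF A(1) ij] kron_one_index[OF A(2) ij]
    using ij by (simp add: rev_mat_def less_mult_imp_div_less)
qed (auto simp: rev_mat_def kron_mat_def)

lemma has_grade_transpose: "has_grade d A \<Longrightarrow> has_grade d A\<^sup>T"
  by (simp add: has_grade_def)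

lemma rev_mat_transpose: "rev_mat d A\<^sup>T = (rev_mat d A)\<^sup>T"
  by (rule eq_matI) (auto simp: rev_mat_def)

lemma has_grade_four_block_mat:
  assumes "A \<in> carrier_mat r c" "B \<in> carrier_mat r d" "C \<in> carrier_mat s c" "D \<in> carrier_mat s d"
    and "has_grade k A" "has_grade k B" "has_grade k C" "has_grade k D"
  shows "has_grade k (four_block_mat A B C D)"
  using assms by (auto simp: has_grade_def)

lemma has_grade_zero: "has_grade d (0\<^sub>m r c)"
  by (simp add: has_grade_def)

lemma rev_mat_L_pencil: "rev_mat 1 (L_pencil k) = bidiagonal k (- [:0, 1:]) 1"
proof -
  have "rev_poly 1 (- 1) = (- [:0, 1:] :: 'a poly)" "rev_poly 1 [:0, 1:] = (1 :: 'a poly)"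
    by (simp_all add: rev_poly_def monom_altdef one_pCons atMost_Suc)
  then show ?thesis
    by (intro eq_matI) (auto simp: rev_mat_def L_pencil_def bidiagonal_def)
qed

lemma rev_mat_Lambda_col: "rev_mat k (Lambda_col k) = mat (k + 1) 1 (\<lambda>(i, _). [:0, 1:] ^ i)"
proof -
  have "rev_poly k ([:0, 1:] ^ (k - i)) = ([:0, 1:] ^ i :: 'a poly)" if "i \<le> k" for i
    using that unfolding monom_altdef[where c = 1, simplified, symmetric]
    by (intro poly_eqI) (auto simp: coeff_rev_poly)
  then show ?thesis
    by (intro eq_matI) (auto simp: rev_mat_def Lambda_col_def)
qed

lemma has_grade_L_pencil: "has_grade 1 (L_pencil k)"
  by (auto simp: has_grade_def L_pencil_def)

lemma has_grade_Lambda_col: "has_grade k (Lambda_col k)"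
  by (auto simp: has_grade_def Lambda_col_def degree_power_eq)

lemma pencil_carrier:
  "M1 \<in> carrier_mat r c \<Longrightarrow> M0 \<in> carrier_mat r c \<Longrightarrow> pencil M1 M0 \<in> carrier_mat r c"
  by (simp add: pencil_def)

lemma has_grade_pencil:
  assumes "M1 \<in> carrier_mat r c" "M0 \<in> carrier_mat r c"
  shows "has_grade 1 (pencil M1 M0)"
  using assms by (auto simp: has_grade_def pencil_def)

lemma transpose_pencil:
  assumes "M1 \<in> carrier_mat r c" "M0 \<in> carrier_mat r c"
  shows "(pencil M1 M0)\<^sup>T = pencil M1\<^sup>T M0\<^sup>T"
  by (rule eq_matI) (use assms in \<open>auto simp: pencil_def\<close>)

section \<open>Linearizations from completed blocks\<close>

lemma linearization_completed_blocks:
  fixes M :: "'a::field poly mat"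
  assumes "completed_blocks p n q m A C W1 W2 Z1 Z2 B D M"
    and "has_grade 1 (four_block_mat M B A (0\<^sub>m p q))" and "has_grade d (Z2 * M * W2)"
  shows "linearization d (four_block_mat M B A (0\<^sub>m p q)) (Z2 * M * W2)"
proof -
  interpret completed_blocks p n q m A C W1 W2 Z1 Z2 B D M by fact
  have "unimodular U" by (rule unimodular_if_inverse(1)[OF carriers_UV(1,2) U_inverse])
  \<comment> \<open>The inverse is known on the left, so \<open>V\<close> is the second factor in
    \<open>unimodular_if_inverse\<close>.\<close>
  moreover have "unimodular V"
    using V_inverse carriers_UV(3) carriers_UV(4)[OF one_carrier_mat]
    by (intro unimodular_if_inverse(2)[of "V' (1\<^sub>m n)" "p + n + q"]) (auto simp: add_ac)
  ultimately show ?thesis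
    using assms(2,3) equivalence carriers_UV unfolding linearization_def L_def[symmetric] Q_def[symmetric]
    by (intro conjI exI[of _ "q + p"] bexI[of _ U] bexI[of _ V]) auto
qed

definition C_compl :: "nat \<Rightarrow> 'a::field poly mat" where
  "C_compl k = mat 1 (k + 1) (\<lambda>(i, j). if j = k then 1 else 0)"
definition W_compl :: "nat \<Rightarrow> 'a::field poly mat" where
  "W_compl k = mat (k + 1) k (\<lambda>(i, j). if i \<le> j then - ([:0, 1:] ^ (j - i)) else 0)"

lemma complementary_L_pencil: "complementary k 1 (L_pencil k) (C_compl k) (W_compl k) (Lambda_col k)"
  using complementary_bidiagonal[of k "[:0, 1:] :: 'a poly"]
  by (simp add: L_pencil_conv_bidiagonal C_compl_def W_compl_def Lambda_col_def)

text \<open>Arbitrary completions are allowed on both sides so that the pencil and its reversal are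
  both instances. The column side uses the transposed completion.\<close>

lemma completed_blocks_kron:
  fixes M :: "'a::comm_ring_1 mat"
  assumes "complementary \<epsilon> 1 A C W1 W2" "complementary \<eta> 1 A' C' W1' W2'"
    and "M \<in> carrier_mat ((\<eta> + 1) * m) ((\<epsilon> + 1) * n)"
  shows "completed_blocks (\<epsilon> * n) n (\<eta> * m) m
    (A \<otimes>\<^sub>m 1\<^sub>m n) (C \<otimes>\<^sub>m 1\<^sub>m n) (W1 \<otimes>\<^sub>m 1\<^sub>m n) (W2 \<otimes>\<^sub>m 1\<^sub>m n)
    (W1'\<^sup>T \<otimes>\<^sub>m 1\<^sub>m m) (W2'\<^sup>T \<otimes>\<^sub>m 1\<^sub>m m) (A'\<^sup>T \<otimes>\<^sub>m 1\<^sub>m m) (C'\<^sup>T \<otimes>\<^sub>m 1\<^sub>m m) M"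
  using complementary_kron_one[OF assms(1), of n]
    complementary_kron_one[OF complementary_transpose[OF assms(2)], of m] assms(3)
  by unfold_locales (auto simp: add.commute)

subsection \<open>Degrees of null vectors\<close>

lemma vec_degree_le_iff: "vec_degree v \<le> d \<longleftrightarrow> (\<forall>i<dim_vec v. degree (v $ i) \<le> d)"
proof -
  have "{degree (v $ i) | i. i < dim_vec v} = (\<lambda>i. degree (v $ i)) ` {..<dim_vec v}" by auto
  then show ?thesis by (auto simp: vec_degree_def)
qed

lemma degree_le_vec_degree: "i < dim_vec v \<Longrightarrow> degree (v $ i) \<le> vec_degree v"
  using vec_degree_le_iff[of v "vec_degree v"] by auto

lemma vec_degree_append: "vec_degree (x @\<^sub>v y) = max (vec_degree x) (vec_degree y)"
proof (rule antisym)
  show "vec_degree (x @\<^sub>v y) \<le> max (vec_degree x) (vec_degree y)"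
    unfolding vec_degree_le_iff
  proof (intro allI impI)
    fix i assume "i < dim_vec (x @\<^sub>v y)"
    then show "degree ((x @\<^sub>v y) $ i) \<le> max (vec_degree x) (vec_degree y)"
      using degree_le_vec_degree[of i x] degree_le_vec_degree[of "i - dim_vec x" y]
      by (cases "i < dim_vec x") (auto simp: le_max_iff_disj)
  qed
  have "degree (x $ i) \<le> vec_degree (x @\<^sub>v y)" if "i < dim_vec x" for i
    using that degree_le_vec_degree[of i "x @\<^sub>v y"] by simp
  moreover have "degree (y $ i) \<le> vec_degree (x @\<^sub>v y)" if "i < dim_vec y" for i
    using that degree_le_vec_degree[of "dim_vec x + i" "x @\<^sub>v y"] by simp
  ultimately show "max (vec_degree x) (vec_degree y) \<le> vec_degree (x @\<^sub>v y)"
    by (simp add: vec_degree_le_iff)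
qed

lemma vec_degree_attained:
  assumes "v \<noteq> 0\<^sub>v (dim_vec v)"
  obtains i where "i < dim_vec v" "v $ i \<noteq> 0" "degree (v $ i) = vec_degree v"
proof -
  obtain j where j: "j < dim_vec v" "v $ j \<noteq> 0" using assms by (auto simp: vec_eq_iff)
  show thesis
  \<comment> \<open>The zero polynomial also has degree 0, so in the first case a nonzero entry has
    to be supplied; in the second case an entry of full degree is automatically nonzero.\<close>
  proof (cases "vec_degree v = 0")
    case True
    then show thesis using j degree_le_vec_degree[OF j(1)] that by auto
  next
    case False
    then have "\<not> vec_degree v \<le> vec_degree v - 1" by simp
    then obtain i where i: "i < dim_vec v" "\<not> degree (v $ i) \<le> vec_degree v - 1"
      unfolding vec_degree_le_iff[of v "vec_degree v - 1"] by blast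
    then have "v $ i \<noteq> 0" by auto
    then show thesis using i degree_le_vec_degree[OF i(1)] that[of i] by linarith
  qed
qed

lemma degree_mult_mat_vec_le:
  assumes A: "A \<in> carrier_mat r c" and v: "v \<in> carrier_vec c" and "has_grade d A" and i: "i < r"
  shows "degree ((A *\<^sub>v v) $ i) \<le> d + vec_degree v"
proof -
  have "degree (A $$ (i, l) * v $ l) \<le> d + vec_degree v" if l: "l < c" for l
  proof -
    have "degree (A $$ (i, l)) \<le> d" using assms l by (auto simp: has_grade_def)
    moreover have "degree (v $ l) \<le> vec_degree v" using v l by (intro degree_le_vec_degree) auto
    ultimately show ?thesis using degree_mult_le[of "A $$ (i, l)" "v $ l"] by linarith
  qed
  moreover have "(A *\<^sub>v v) $ i = (\<Sum>l<c. A $$ (i, l) * v $ l)"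
    using A v i by (simp add: scalar_prod_def atLeast0LessThan)
  ultimately show ?thesis by (auto intro: degree_sum_le)
qed

text \<open>The grade of \<open>Lambda_col k\<close> gives the upper bound. It is attained in the
  first block of the product, which is \<open>z\<close> times the \<open>k\<close>-th power of the
  indeterminate.\<close>

lemma vec_degree_Lambda_col_kron:
  fixes z :: "'a::field poly vec"
  assumes z: "z \<in> carrier_vec n" and z0: "z \<noteq> 0\<^sub>v n"
  shows "vec_degree ((Lambda_col k \<otimes>\<^sub>m 1\<^sub>m n) *\<^sub>v z) = vec_degree z + k"
proof -
  let ?L = "Lambda_col k :: 'a poly mat"
  have L: "?L \<in> carrier_mat (k + 1) 1" by (simp add: Lambda_col_def)
  have K: "?L \<otimes>\<^sub>m 1\<^sub>m n \<in> carrier_mat ((k + 1) * n) n"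
    using kron_mat_carrier[OF L one_carrier_mat[of n]] by simp
  show ?thesis
  proof (rule antisym)
    have "degree (((?L \<otimes>\<^sub>m 1\<^sub>m n) *\<^sub>v z) $ i) \<le> k + vec_degree z" if "i < (k + 1) * n" for i
      using that by (rule degree_mult_mat_vec_le[OF K z has_grade_kron_one[OF has_grade_Lambda_col]])
    then show "vec_degree ((?L \<otimes>\<^sub>m 1\<^sub>m n) *\<^sub>v z) \<le> vec_degree z + k"
      using K by (auto simp: vec_degree_le_iff add.commute)
    obtain j where j: "j < n" "z $ j \<noteq> 0" "degree (z $ j) = vec_degree z"
      using z z0 vec_degree_attained[of z] by auto
    then have jk: "j < (k + 1) * n" by simp
    have "((?L \<otimes>\<^sub>m 1\<^sub>m n) *\<^sub>v z) $ j = [:0, 1:] ^ k * z $ j"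
      using kron_one_mult_vec_index[OF L, of z n j] z j jk by (simp add: Lambda_col_def)
    then have "degree (((?L \<otimes>\<^sub>m 1\<^sub>m n) *\<^sub>v z) $ j) = vec_degree z + k"
      using j by (simp add: degree_mult_eq degree_power_eq)
    then show "vec_degree z + k \<le> vec_degree ((?L \<otimes>\<^sub>m 1\<^sub>m n) *\<^sub>v z)"
      using degree_le_vec_degree[of j "(?L \<otimes>\<^sub>m 1\<^sub>m n) *\<^sub>v z"] K jk by simp
  qed
qed

text \<open>The leading coefficient of \<open>L_pencil k\<close> transposed has full column rank, so multiplication by
  it raises the degree of a vector by exactly one.\<close>

lemma vec_degree_le_if_transpose_L_pencil_kron:
  fixes y :: "'a::field poly vec"
  assumes y: "y \<in> carrier_vec (k * m)"
    and deg: "\<And>i. i < (k + 1) * m \<Longrightarrow> degree ((((L_pencil k)\<^sup>T \<otimes>\<^sub>m 1\<^sub>m m) *\<^sub>v y) $ i) \<le> Suc d"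
  shows "vec_degree y \<le> d"
proof (rule ccontr)
  let ?B = "(L_pencil k)\<^sup>T :: 'a poly mat" and ?x = "[:0, 1:] :: 'a poly"
  have B: "?B \<in> carrier_mat (k + 1) k" by (simp add: L_pencil_def)
  assume big: "\<not> vec_degree y \<le> d"
  then have "y \<noteq> 0\<^sub>v (dim_vec y)"
    by (auto simp: vec_degree_le_iff vec_eq_iff)
  then obtain i where i: "i < k * m" "y $ i \<noteq> 0" "degree (y $ i) = vec_degree y"
    using y vec_degree_attained[of y] by auto
  then have m: "0 < m" by (auto intro: Nat.gr0I)
  define a where "a = i div m"
  have a: "a < k" using i by (simp add: a_def less_mult_imp_div_less)
  \<comment> \<open>Row \<open>i + m\<close> is the one that multiplies the full-degree entry
    \<open>y $ i\<close> by the indeterminate. Its only other term is \<open>- y $ (i + m)\<close>,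
    absent for the last block, whose degree is too small to cancel the leading term.\<close>
  have im: "i + m < (k + 1) * m" using i by simp
  have div: "(i + m) div m = a + 1" "(i + m) mod m = i mod m" using m by (auto simp: a_def)
  have "((?B \<otimes>\<^sub>m 1\<^sub>m m) *\<^sub>v y) $ (i + m) = (\<Sum>l<k. ?B $$ (a + 1, l) * y $ (l * m + i mod m))"
    using kron_one_mult_vec_index[OF B y im] by (simp only: div)
  also have "\<dots> = (\<Sum>l<k. (if l = a then ?x * y $ (a * m + i mod m) else 0)
      + (if l = a + 1 then - y $ ((a + 1) * m + i mod m) else 0))"
    using a by (intro sum.cong refl) (auto simp: L_pencil_def)
  also have "\<dots> = ?x * y $ i + (if a + 1 < k then - y $ (i + m) else 0)"
    using a div_mult_mod_eq[of i m] by (subst sum.distrib) (simp add: a_def algebra_simps)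
  finally have eq: "((?B \<otimes>\<^sub>m 1\<^sub>m m) *\<^sub>v y) $ (i + m) = ?x * y $ i + (if a + 1 < k then - y $ (i + m) else 0)" .
  have "i + m < k * m" if "a + 1 < k"
  proof -
    have "(i + m) div m < k" using that div by simp
    then show ?thesis by (simp only: div_less_iff_less_mult[OF m])
  qed
  then have "degree (if a + 1 < k then - y $ (i + m) else 0) \<le> vec_degree y"
    using y degree_le_vec_degree[of "i + m" y] by auto
  moreover have x: "degree (?x * y $ i) = Suc (vec_degree y)"
    using i by (simp add: degree_mult_eq)
  ultimately have "degree (?x * y $ i + (if a + 1 < k then - y $ (i + m) else 0)) = Suc (vec_degree y)"
    by (subst degree_add_eq_left) auto
  then show False using deg[OF im] big unfolding eq by simp
qed

section \<open>Right minimal indices of the block Kronecker pencil\<close>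

lemma right_minimal_indices_block_kronecker_pencil:
  fixes M1 M0 :: "'a::field mat"
  assumes M1: "M1 \<in> carrier_mat ((\<eta> + 1) * m) ((\<epsilon> + 1) * n)"
    and M0: "M0 \<in> carrier_mat ((\<eta> + 1) * m) ((\<epsilon> + 1) * n)"
  shows "right_minimal_indices (block_kronecker_pencil \<epsilon> n \<eta> m M1 M0) =
    map (\<lambda>\<alpha>. \<alpha> + \<epsilon>) (right_minimal_indices
      (((Lambda_col \<eta>)\<^sup>T \<otimes>\<^sub>m 1\<^sub>m m) * pencil M1 M0 * (Lambda_col \<epsilon> \<otimes>\<^sub>m 1\<^sub>m n)))"
proof -
  let ?M = "pencil M1 M0"
  let ?A = "L_pencil \<epsilon> \<otimes>\<^sub>m 1\<^sub>m n :: 'a poly mat" and ?C = "C_compl \<epsilon> \<otimes>\<^sub>m 1\<^sub>m n :: 'a poly mat"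
    and ?W1 = "W_compl \<epsilon> \<otimes>\<^sub>m 1\<^sub>m n :: 'a poly mat" and ?W2 = "Lambda_col \<epsilon> \<otimes>\<^sub>m 1\<^sub>m n :: 'a poly mat"
    and ?Z1 = "(W_compl \<eta>)\<^sup>T \<otimes>\<^sub>m 1\<^sub>m m :: 'a poly mat" and ?Z2 = "(Lambda_col \<eta>)\<^sup>T \<otimes>\<^sub>m 1\<^sub>m m :: 'a poly mat"
    and ?B = "(L_pencil \<eta>)\<^sup>T \<otimes>\<^sub>m 1\<^sub>m m :: 'a poly mat" and ?D = "(C_compl \<eta>)\<^sup>T \<otimes>\<^sub>m 1\<^sub>m m :: 'a poly mat"
  have Mc: "?M \<in> carrier_mat ((\<eta> + 1) * m) ((\<epsilon> + 1) * n)" by (rule pencil_carrier[OF M1 M0])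
  interpret K: completed_blocks "\<epsilon> * n" n "\<eta> * m" m ?A ?C ?W1 ?W2 ?Z1 ?Z2 ?B ?D ?M
    by (rule completed_blocks_kron[OF complementary_L_pencil complementary_L_pencil Mc])
  let ?h = "map_mat to_fract :: 'a poly mat \<Rightarrow> _"
  \<comment> \<open>The same elimination over the rational functions: \<open>F\<close> describes the
    null spaces, while \<open>K\<close> supplies the polynomial matrices behind the maps.\<close>
  interpret F: completed_blocks "\<epsilon> * n" n "\<eta> * m" m "?h ?A" "?h ?C" "?h ?W1" "?h ?W2"
    "?h ?Z1" "?h ?Z2" "?h ?B" "?h ?D" "?h ?M"
    using to_fract_hom.complementary_hom[OF K.AC] to_fract_hom.complementary_hom[OF K.ZB] K.M
    by unfold_locales auto
  note c = K.carriers K.M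
  have L: "block_kronecker_pencil \<epsilon> n \<eta> m M1 M0 = K.L"
    by (simp add: block_kronecker_pencil_def K.L_def)
  have "?h (0\<^sub>m r s) = 0\<^sub>m r s" for r s by (rule eq_matI) auto
  then have FL: "F.L = ?h K.L"
    unfolding F.L_def K.L_def using map_four_block_mat[OF c(9) c(7) c(1) zero_carrier_mat, of to_fract]
    by simp
  have ZM: "?Z2 * ?M \<in> carrier_mat m (\<epsilon> * n + n)" and ZM1: "?Z1 * ?M \<in> carrier_mat (\<eta> * m) (\<epsilon> * n + n)"
    using c by auto
  have FQ: "F.Q = ?h K.Q"
    unfolding F.Q_def K.Q_def to_fract_hom.mat_hom_mult[OF ZM c(4)] to_fract_hom.mat_hom_mult[OF c(6) c(9)] ..
  have ZMW: "?Z1 * ?M * ?W2 \<in> carrier_mat (\<eta> * m) n" using ZM1 c by auto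
  have FPhi: "F.Phi = ?h K.Phi"
  proof -
    have "?h K.Phi = ?h ?W2 @\<^sub>r ?h (- (?Z1 * ?M * ?W2))"
      unfolding K.Phi_def using c ZMW by (intro eq_matI) (auto simp: append_rows_def)
    also have "?h (- (?Z1 * ?M * ?W2)) = - ?h (?Z1 * ?M * ?W2)" by (rule eq_matI) auto
    finally show ?thesis
      unfolding F.Phi_def to_fract_hom.mat_hom_mult[OF ZM1 c(4)] to_fract_hom.mat_hom_mult[OF c(5) c(9)] ..
  qed
  have im: "right_null_space K.L = (*\<^sub>v) (?h K.Phi) ` right_null_space K.Q"
    using F.mat_kernel_L unfolding FL FQ FPhi right_null_space_conv_mat_kernel .
  have "vec_degree (K.Phi *\<^sub>v z) = vec_degree z + \<epsilon>"
    if z: "z \<in> carrier_vec n" and Nz: "map_vec to_fract z \<in> right_null_space K.Q" and z0: "z \<noteq> 0\<^sub>v n" for z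
  proof -
    have Qz: "z \<in> mat_kernel K.Q"
    proof (rule mat_kernelI[OF K.carriers_UV(6) z])
      have "map_vec to_fract (K.Q *\<^sub>v z) = map_vec to_fract (0\<^sub>v m)"
        using Nz K.carriers_UV(6) to_fract_hom.mult_mat_vec_hom[OF K.carriers_UV(6) z]
        by (auto simp: right_null_space_def to_fract_hom.vec_hom_zero)
      then show "K.Q *\<^sub>v z = 0\<^sub>v m" by (rule to_fract_hom.vec_hom_inj)
    qed
    define x y where "x = ?W2 *\<^sub>v z" and "y = (- (?Z1 * ?M * ?W2)) *\<^sub>v z"
    have x: "x \<in> carrier_vec (\<epsilon> * n + n)" and y: "y \<in> carrier_vec (\<eta> * m)"
      unfolding x_def y_def
      using mult_mat_vec_carrier[OF c(4) z] mult_mat_vec_carrier[OF uminus_carrier_mat[OF ZMW] z] by auto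
    have Phi: "K.Phi *\<^sub>v z = x @\<^sub>v y"
      unfolding K.Phi_def x_def y_def using c ZMW z by (intro mat_mult_append) auto
    have dx: "vec_degree x = vec_degree z + \<epsilon>"
      unfolding x_def by (rule vec_degree_Lambda_col_kron[OF z z0])
    have "K.L *\<^sub>v (x @\<^sub>v y) = 0\<^sub>v (\<eta> * m + m + \<epsilon> * n)"
      using K.mat_kernel_L Qz Phi mat_kernelD(2)[OF K.carriers_UV(5)] by force
    moreover have "K.L *\<^sub>v (x @\<^sub>v y) = (?M *\<^sub>v x + ?B *\<^sub>v y) @\<^sub>v (?A *\<^sub>v x + 0\<^sub>m (\<epsilon> * n) (\<eta> * m) *\<^sub>v y)"
      unfolding K.L_def by (rule four_block_mat_mult_vec[OF c(9) c(7) c(1) zero_carrier_mat x y])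
    ultimately have zero: "(?M *\<^sub>v x + ?B *\<^sub>v y) @\<^sub>v (?A *\<^sub>v x + 0\<^sub>m (\<epsilon> * n) (\<eta> * m) *\<^sub>v y)
        = 0\<^sub>v (\<eta> * m + m + \<epsilon> * n)" (is "?u @\<^sub>v ?v = _") by simp
    have eq: "(?M *\<^sub>v x) $ i + (?B *\<^sub>v y) $ i = 0" if i: "i < \<eta> * m + m" for i
    proof -
      have "(?M *\<^sub>v x) $ i + (?B *\<^sub>v y) $ i = ?u $ i"
        using carrier_matD[OF c(7)] i by simp
      also have "\<dots> = (?u @\<^sub>v ?v) $ i"
        using carrier_matD[OF c(7)] carrier_matD[OF c(9)] i by (simp del: index_add_vec(1) index_mult_mat_vec)
      finally show ?thesis using i by (simp add: zero)
    qed
    \<comment> \<open>\<open>B y = - M x\<close> has degree at most one more than \<open>x\<close>,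
      and \<open>B\<close> raises the degree of \<open>y\<close> by one, so \<open>y\<close> cannot
      exceed the degree of \<open>x\<close>.\<close>
    have "vec_degree y \<le> vec_degree z + \<epsilon>"
    proof (rule vec_degree_le_if_transpose_L_pencil_kron[OF y])
      fix i assume "i < (\<eta> + 1) * m"
      then have i: "i < \<eta> * m + m" by (simp add: add.commute)
      have "degree ((?M *\<^sub>v x) $ i) \<le> 1 + vec_degree x"
        by (rule degree_mult_mat_vec_le[OF c(9) x has_grade_pencil[OF M1 M0] i])
      moreover have "(?B *\<^sub>v y) $ i = - (?M *\<^sub>v x) $ i" using eq[OF i] by (simp add: add_eq_0_iff)
      ultimately show "degree ((?B *\<^sub>v y) $ i) \<le> Suc (vec_degree z + \<epsilon>)" by (simp add: dx)
    qed
    then show ?thesis unfolding Phi vec_degree_append by (simp add: dx)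
  qed
  \<comment> \<open>This is the polynomial left inverse of \<open>K.Phi\<close> from
    \<open>Psi_mult_Phi\<close>.\<close>
  moreover have "?C @\<^sub>c 0\<^sub>m n (\<eta> * m) \<in> carrier_mat n (\<epsilon> * n + n + \<eta> * m)" using c by auto
  ultimately have "right_minimal_indices K.L = map (\<lambda>\<alpha>. \<alpha> + \<epsilon>) (right_minimal_indices K.Q)"
    by (intro right_minimal_indices_shift[OF K.carriers_UV(6,5,7) _ K.Psi_mult_Phi im])
  then show ?thesis by (simp only: L K.Q_def)
qed

theorem theorem4p2:
  fixes \<epsilon> n \<eta> m :: nat and M1 M0 :: "'a::field mat" and L Q :: "'a poly mat"
  assumes M1: "M1 \<in> carrier_mat ((\<eta> + 1) * m) ((\<epsilon> + 1) * n)"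
    and M0: "M0 \<in> carrier_mat ((\<eta> + 1) * m) ((\<epsilon> + 1) * n)"
  defines "L \<equiv> block_kronecker_pencil \<epsilon> n \<eta> m M1 M0"
    and "Q \<equiv> (transpose_mat (Lambda_col \<eta>) \<otimes>\<^sub>m 1\<^sub>m m) * pencil M1 M0 * (Lambda_col \<epsilon> \<otimes>\<^sub>m 1\<^sub>m n)"
  shows "Q \<in> carrier_mat m n \<and>
    strong_linearization (\<epsilon> + \<eta> + 1) L Q \<and>
    right_minimal_indices L = map (\<lambda>\<alpha>. \<alpha> + \<epsilon>) (right_minimal_indices Q) \<and>
    left_minimal_indices L = map (\<lambda>\<alpha>. \<alpha> + \<eta>) (left_minimal_indices Q)"
proof (intro conjI)
  let ?M = "pencil M1 M0" and ?x = "[:0, 1:] :: 'a poly"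
  let ?\<Lambda> = "\<lambda>k. Lambda_col k :: 'a poly mat" and ?L = "\<lambda>k. L_pencil k :: 'a poly mat"
  have Mc: "?M \<in> carrier_mat ((\<eta> + 1) * m) ((\<epsilon> + 1) * n)" by (rule pencil_carrier[OF M1 M0])
  have Lc: "(?L k)\<^sup>T \<otimes>\<^sub>m 1\<^sub>m t \<in> carrier_mat ((k + 1) * t) (k * t)" "?L k \<otimes>\<^sub>m 1\<^sub>m t \<in> carrier_mat (k * t) ((k + 1) * t)" for k t
    by (intro kron_mat_carrier; simp add: L_pencil_def)+
  have \<Lambda>c: "(?\<Lambda> \<eta>)\<^sup>T \<otimes>\<^sub>m 1\<^sub>m m \<in> carrier_mat m ((\<eta> + 1) * m)" "?\<Lambda> \<epsilon> \<otimes>\<^sub>m 1\<^sub>m n \<in> carrier_mat ((\<epsilon> + 1) * n) n"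
    using kron_mat_carrier[of "(?\<Lambda> \<eta>)\<^sup>T" 1 "\<eta> + 1" "1\<^sub>m m" m m]
      kron_mat_carrier[of "?\<Lambda> \<epsilon>" "\<epsilon> + 1" 1 "1\<^sub>m n" n n] by (auto simp: Lambda_col_def)
  show Q: "Q \<in> carrier_mat m n" unfolding Q_def using \<Lambda>c Mc by auto
  have grade_\<Lambda>: "has_grade \<eta> ((?\<Lambda> \<eta>)\<^sup>T \<otimes>\<^sub>m 1\<^sub>m m)" "has_grade \<epsilon> (?\<Lambda> \<epsilon> \<otimes>\<^sub>m 1\<^sub>m n)"
    by (intro has_grade_kron_one has_grade_transpose has_grade_Lambda_col)+
  note grade_M = has_grade_pencil[OF M1 M0]
  note grade_\<Lambda>M = has_grade_mult[OF \<Lambda>c(1) Mc grade_\<Lambda>(1) grade_M]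
  have \<Lambda>M: "((?\<Lambda> \<eta>)\<^sup>T \<otimes>\<^sub>m 1\<^sub>m m) * ?M \<in> carrier_mat m ((\<epsilon> + 1) * n)" using \<Lambda>c Mc by auto
  have d: "\<eta> + 1 + \<epsilon> = \<epsilon> + \<eta> + 1" by simp
  have gradeQ: "has_grade (\<epsilon> + \<eta> + 1) Q"
    using has_grade_mult[OF \<Lambda>M \<Lambda>c(2) grade_\<Lambda>M grade_\<Lambda>(2)] unfolding Q_def d .
  have gradeL: "has_grade 1 L"
    unfolding L_def block_kronecker_pencil_def
    by (intro has_grade_four_block_mat[OF Mc Lc(1) Lc(2)] zero_carrier_mat grade_M has_grade_zero
        has_grade_kron_one has_grade_transpose has_grade_L_pencil)
  have "linearization (\<epsilon> + \<eta> + 1) L Q"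
    using linearization_completed_blocks[OF completed_blocks_kron[OF complementary_L_pencil
          complementary_L_pencil Mc]] gradeL gradeQ
    unfolding L_def Q_def block_kronecker_pencil_def by blast
  moreover have "linearization (\<epsilon> + \<eta> + 1) (rev_mat 1 L) (rev_mat (\<epsilon> + \<eta> + 1) Q)"
  proof -
    \<comment> \<open>Reversal acts blockwise and commutes with \<open>\<otimes>\<^sub>m\<close> by
      an identity, so the off-diagonal blocks stay bidiagonal and
      \<open>complementary_rev_bidiagonal\<close> completes them.\<close>
    have revL: "rev_mat 1 L = four_block_mat (rev_mat 1 ?M) ((bidiagonal \<eta> (- ?x) 1)\<^sup>T \<otimes>\<^sub>m 1\<^sub>m m)
        (bidiagonal \<epsilon> (- ?x) 1 \<otimes>\<^sub>m 1\<^sub>m n) (0\<^sub>m (\<epsilon> * n) (\<eta> * m))"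
    proof -
      have "rev_mat 1 (0\<^sub>m (\<epsilon> * n) (\<eta> * m)) = (0\<^sub>m (\<epsilon> * n) (\<eta> * m) :: 'a poly mat)"
        by (rule eq_matI) (auto simp: rev_mat_def)
      then show ?thesis
        using map_four_block_mat[OF Mc Lc(1) Lc(2) zero_carrier_mat, of "rev_poly 1"]
        unfolding L_def block_kronecker_pencil_def rev_mat_def[symmetric] rev_mat_kron_one
          rev_mat_transpose rev_mat_L_pencil by simp
    qed
    \<comment> \<open>The three factors of \<open>Q\<close> have grades \<open>\<eta>\<close>, 1 and
      \<open>\<epsilon>\<close>. Since these add up to the grade of \<open>Q\<close>, the reversal
      distributes over the product.\<close>
    have revQ: "rev_mat (\<epsilon> + \<eta> + 1) Q = ((mat (\<eta> + 1) 1 (\<lambda>(i, _). ?x ^ i))\<^sup>T \<otimes>\<^sub>m 1\<^sub>m m) * rev_mat 1 ?M *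
        (mat (\<epsilon> + 1) 1 (\<lambda>(i, _). ?x ^ i) \<otimes>\<^sub>m 1\<^sub>m n)"
      using rev_mat_mult[OF \<Lambda>M \<Lambda>c(2) grade_\<Lambda>M grade_\<Lambda>(2)]
      unfolding Q_def d rev_mat_mult[OF \<Lambda>c(1) Mc grade_\<Lambda>(1) grade_M] rev_mat_kron_one
        rev_mat_transpose rev_mat_Lambda_col .
    have "rev_mat 1 ?M \<in> carrier_mat ((\<eta> + 1) * m) ((\<epsilon> + 1) * n)" using Mc by (simp add: rev_mat_def)
    from linearization_completed_blocks[OF completed_blocks_kron[OF complementary_rev_bidiagonal[of \<epsilon> ?x]
          complementary_rev_bidiagonal[of \<eta> ?x] this], folded revL revQ]
    show ?thesis using has_grade_rev_mat by blast
  qed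
  ultimately show "strong_linearization (\<epsilon> + \<eta> + 1) L Q" by (simp add: strong_linearization_def)
  show "right_minimal_indices L = map (\<lambda>\<alpha>. \<alpha> + \<epsilon>) (right_minimal_indices Q)"
    unfolding L_def Q_def by (rule right_minimal_indices_block_kronecker_pencil[OF M1 M0])
  \<comment> \<open>The transpose is again a block Kronecker pencil, with the pairs
    \<open>\<epsilon>\<close>, \<open>n\<close> and \<open>\<eta>\<close>, \<open>m\<close>
    exchanged, so the result on right indices yields the left ones with shift
    \<open>\<eta>\<close>.\<close>
  have LT: "L\<^sup>T = block_kronecker_pencil \<eta> m \<epsilon> n M1\<^sup>T M0\<^sup>T"
    unfolding L_def block_kronecker_pencil_def transpose_four_block_mat[OF Mc Lc(1) Lc(2) zero_carrier_mat]
    by (simp add: transpose_kron_mat transpose_pencil[OF M1 M0])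
  have QT: "Q\<^sup>T = ((?\<Lambda> \<epsilon>)\<^sup>T \<otimes>\<^sub>m 1\<^sub>m n) * pencil M1\<^sup>T M0\<^sup>T * (?\<Lambda> \<eta> \<otimes>\<^sub>m 1\<^sub>m m)"
  proof -
    have "Q\<^sup>T = (?\<Lambda> \<epsilon> \<otimes>\<^sub>m 1\<^sub>m n)\<^sup>T * (?M\<^sup>T * ((?\<Lambda> \<eta>)\<^sup>T \<otimes>\<^sub>m 1\<^sub>m m)\<^sup>T)"
      unfolding Q_def transpose_mult[OF \<Lambda>M \<Lambda>c(2)] transpose_mult[OF \<Lambda>c(1) Mc] ..
    also have "\<dots> = (?\<Lambda> \<epsilon> \<otimes>\<^sub>m 1\<^sub>m n)\<^sup>T * ?M\<^sup>T * ((?\<Lambda> \<eta>)\<^sup>T \<otimes>\<^sub>m 1\<^sub>m m)\<^sup>T"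
      using \<Lambda>c Mc by (intro assoc_mult_mat[symmetric]) auto
    finally show ?thesis by (simp add: transpose_kron_mat transpose_pencil[OF M1 M0])
  qed
  show "left_minimal_indices L = map (\<lambda>\<alpha>. \<alpha> + \<eta>) (left_minimal_indices Q)"
    unfolding left_minimal_indices_conv_transpose LT QT
    by (rule right_minimal_indices_block_kronecker_pencil) (use M1 M0 in auto)
qed

end
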